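(* No finite thick generalised hexagon and no finite thick generalised octagon admits an anisotropic automorphism.
   Context: A generalised $n$-gon ($n\geq 2$; hexagon for $n=6$, octagon for $n=8$) is a nonempty point-line geometry $\Gamma=(\mathcal{P},\mathcal{L},\mathbf{I})$ containing no ordinary $k$-gon (as a subgeometry) for $2\leq k<n$ and such that any two elements of $\mathcal{P}\cup\mathcal{L}$ are contained in some ordinary $n$-gon in $\Gamma$. It is thick if each point is on at least $3$ lines and each line contains at least $3$ points. An automorphism is a bijection of $\mathcal{P}\cup\mathcal{L}$ preserving incidence and non-incidence, which either preserves $\mathcal{P}$ and $\mathcal{L}$ (collineation) or interchanges them (duality). Two elements are opposite if they are at distance $n$ in the incidence graph. A chamber is an incident point-line pair; for $n$ even, chambers $\{p,L\}$ and $\{p',L'\}$ are opposite if $p,p'$ are opposite and $L,L'$ are opposite. An automorphism is anisotropic if it maps every chamber to an opposite chamber. *)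

theory Defs
  imports Main "HOL-Library.Extended_Nat"
begin

record 'a pl_geometry =
  points :: "'a set"
  lines :: "'a set"
  inc :: "('a \<times> 'a) set"

definition elements :: "'a pl_geometry \<Rightarrow> 'a set" where
  "elements \<Gamma> = points \<Gamma> \<union> lines \<Gamma>"

definition point_line_geometry :: "'a pl_geometry \<Rightarrow> bool" where
  "point_line_geometry \<Gamma> \<longleftrightarrow>
     points \<Gamma> \<inter> lines \<Gamma> = {} \<and> inc \<Gamma> \<subseteq> points \<Gamma> \<times> lines \<Gamma>"

definition incidence_graph :: "'a pl_geometry \<Rightarrow> 'a rel" where
  "incidence_graph \<Gamma> = inc \<Gamma> \<union> (inc \<Gamma>)\<inverse>"

text \<open>
  The subgeometry induced on the points \<open>A\<close> and the lines \<open>B\<close> is an ordinary \<open>k\<close>-gon, in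
  cyclic order \<open>p 0, l 0, p 1, l 1, \<dots>, p (k - 1), l (k - 1)\<close>. For \<open>k = 2\<close> this means two
  distinct points both incident with two distinct lines.
\<close>
definition ordinary_polygon :: "nat \<Rightarrow> 'a pl_geometry \<Rightarrow> 'a set \<Rightarrow> 'a set \<Rightarrow> bool" where
  "ordinary_polygon k \<Gamma> A B \<longleftrightarrow>
     A \<subseteq> points \<Gamma> \<and> B \<subseteq> lines \<Gamma> \<and>
     (\<exists>p l. bij_betw p {..<k} A \<and> bij_betw l {..<k} B \<and>
        (\<forall>i<k. \<forall>j<k. (p i, l j) \<in> inc \<Gamma> \<longleftrightarrow> i = j \<or> i = Suc j mod k))"

definition generalised_polygon :: "nat \<Rightarrow> 'a pl_geometry \<Rightarrow> bool" where
  "generalised_polygon n \<Gamma> \<longleftrightarrow>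
     n \<ge> 2 \<and> point_line_geometry \<Gamma> \<and> elements \<Gamma> \<noteq> {} \<and>
     (\<forall>k. 2 \<le> k \<and> k < n \<longrightarrow> \<not> (\<exists>A B. ordinary_polygon k \<Gamma> A B)) \<and>
     (\<forall>x \<in> elements \<Gamma>. \<forall>y \<in> elements \<Gamma>.
        \<exists>A B. ordinary_polygon n \<Gamma> A B \<and> {x, y} \<subseteq> A \<union> B)"

definition finite_geometry :: "'a pl_geometry \<Rightarrow> bool" where
  "finite_geometry \<Gamma> \<longleftrightarrow> finite (points \<Gamma>) \<and> finite (lines \<Gamma>)"

text \<open>
  Three-element subsets are used because \<open>card\<close> is \<open>0\<close> on infinite sets, and thickness is meant
  for infinite geometries as well.
\<close>
definition thick :: "'a pl_geometry \<Rightarrow> bool" where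
  "thick \<Gamma> \<longleftrightarrow>
     (\<forall>p \<in> points \<Gamma>. \<exists>S \<subseteq> {l \<in> lines \<Gamma>. (p, l) \<in> inc \<Gamma>}. card S = 3) \<and>
     (\<forall>l \<in> lines \<Gamma>. \<exists>S \<subseteq> {p \<in> points \<Gamma>. (p, l) \<in> inc \<Gamma>}. card S = 3)"

definition collineation :: "'a pl_geometry \<Rightarrow> ('a \<Rightarrow> 'a) \<Rightarrow> bool" where
  "collineation \<Gamma> \<theta> \<longleftrightarrow>
     bij_betw \<theta> (elements \<Gamma>) (elements \<Gamma>) \<and>
     (\<forall>x \<in> elements \<Gamma>. \<forall>y \<in> elements \<Gamma>.
        (\<theta> x, \<theta> y) \<in> incidence_graph \<Gamma> \<longleftrightarrow> (x, y) \<in> incidence_graph \<Gamma>) \<and>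
     \<theta> ` points \<Gamma> = points \<Gamma> \<and> \<theta> ` lines \<Gamma> = lines \<Gamma>"

definition duality :: "'a pl_geometry \<Rightarrow> ('a \<Rightarrow> 'a) \<Rightarrow> bool" where
  "duality \<Gamma> \<theta> \<longleftrightarrow>
     bij_betw \<theta> (elements \<Gamma>) (elements \<Gamma>) \<and>
     (\<forall>x \<in> elements \<Gamma>. \<forall>y \<in> elements \<Gamma>.
        (\<theta> x, \<theta> y) \<in> incidence_graph \<Gamma> \<longleftrightarrow> (x, y) \<in> incidence_graph \<Gamma>) \<and>
     \<theta> ` points \<Gamma> = lines \<Gamma> \<and> \<theta> ` lines \<Gamma> = points \<Gamma>"

definition automorphism :: "'a pl_geometry \<Rightarrow> ('a \<Rightarrow> 'a) \<Rightarrow> bool" where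
  "automorphism \<Gamma> \<theta> \<longleftrightarrow> collineation \<Gamma> \<theta> \<or> duality \<Gamma> \<theta>"

text \<open>Graph distance: the infimum of the lengths of walks; it is \<open>\<infinity>\<close> if there is no walk.\<close>
definition incidence_dist :: "'a pl_geometry \<Rightarrow> 'a \<Rightarrow> 'a \<Rightarrow> enat" where
  "incidence_dist \<Gamma> x y = (INF k \<in> {k. (x, y) \<in> incidence_graph \<Gamma> ^^ k}. enat k)"

definition opposite :: "nat \<Rightarrow> 'a pl_geometry \<Rightarrow> 'a \<Rightarrow> 'a \<Rightarrow> bool" where
  "opposite n \<Gamma> x y \<longleftrightarrow>
     x \<in> elements \<Gamma> \<and> y \<in> elements \<Gamma> \<and> incidence_dist \<Gamma> x y = enat n"

definition chamber :: "'a pl_geometry \<Rightarrow> 'a set \<Rightarrow> bool" where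
  "chamber \<Gamma> C \<longleftrightarrow> (\<exists>p l. (p, l) \<in> inc \<Gamma> \<and> C = {p, l})"

text \<open>
  This is the notion for even \<open>n\<close> only: for odd \<open>n\<close> points are opposite lines. The
  representations \<open>{p, l}\<close> and \<open>{p', l'}\<close> are unique because points and lines are disjoint.
\<close>
definition opposite_chambers :: "nat \<Rightarrow> 'a pl_geometry \<Rightarrow> 'a set \<Rightarrow> 'a set \<Rightarrow> bool" where
  "opposite_chambers n \<Gamma> C D \<longleftrightarrow>
     (\<exists>p l p' l'. (p, l) \<in> inc \<Gamma> \<and> (p', l') \<in> inc \<Gamma> \<and> C = {p, l} \<and> D = {p', l'} \<and>
        opposite n \<Gamma> p p' \<and> opposite n \<Gamma> l l')"

definition anisotropic :: "nat \<Rightarrow> 'a pl_geometry \<Rightarrow> ('a \<Rightarrow> 'a) \<Rightarrow> bool" where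
  "anisotropic n \<Gamma> \<theta> \<longleftrightarrow> (\<forall>C. chamber \<Gamma> C \<longrightarrow> opposite_chambers n \<Gamma> C (\<theta> ` C))"

end

theory Submission
  imports Defs "Jordan_Normal_Form.Schur_Decomposition" "HOL-Combinatorics.Cycles"
begin

text \<open>
  A duality cannot be anisotropic, because the image of a line \<open>l\<close> is a point that is not opposite
  the point of \<open>l\<close> nearest to it. An anisotropic collineation \<open>\<theta>\<close> maps every point to an opposite
  point. Let the order be \<open>(s, t)\<close>. An eigenspace of the collinearity graph has a projection \<open>E\<close>
  whose entries depend only on the distance and which commutes with the permutation matrix \<open>Q\<close> of
  \<open>\<theta>\<close>, so \<open>tr (E Q)\<close> is the number of points times the entry of \<open>E\<close> at distance \<open>n\<close>. Being a sum
  of roots of unity, it is an algebraic integer.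

  For octagons the eigenvalue \<open>s - 1\<close> makes \<open>(1 + s)(1 + t)(1 + s\<^sup>2 t\<^sup>2) / (2 s t (s + t))\<close> an integer, so
  \<open>s\<close> divides \<open>t + 1\<close> and \<open>t\<close> divides \<open>s + 1\<close>, which leaves only \<open>{s, t} = {2, 3}\<close>. For hexagons
  let \<open>z, z'\<close> be the traces belonging to \<open>s - 1 \<plusminus> \<surd>(s t)\<close>. Integrality of \<open>z + z'\<close> and of
  \<open>(z - z')\<^sup>2\<close> gives \<open>D = s\<^sup>2 + s t + t\<^sup>2\<close> dividing \<open>(s\<^sup>2 - 1)(t\<^sup>2 - 1)\<close> and
  \<open>(1 + s + t)\<^sup>2 = k s t\<close>. Vieta jumping restricts \<open>k\<close> to \<open>5, 6, 8, 9\<close>, and then \<open>D\<close> divides a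
  resultant that depends only on \<open>k\<close>, so that finitely many cases remain.
\<close>

section \<open>Traces of permuted projections\<close>

text \<open>The additive group generated by \<open>1, \<zeta>, ..., \<zeta> ^ (N - 1)\<close>: a
  finitely generated module on which integrality can be tested.\<close>

definition power_span :: "nat \<Rightarrow> complex \<Rightarrow> complex set" where
  "power_span N \<zeta> = range (\<lambda>a::nat \<Rightarrow> int. \<Sum>j<N. of_int (a j) * \<zeta> ^ j)"

text \<open>The stabiliser of a module is closed under sums and products by construction, and
  stabilising a nonzero finitely generated module forces integrality. All traces are kept inside one
  such ring.\<close>

definition multiplier_ring :: "nat \<Rightarrow> complex \<Rightarrow> complex set" where
  "multiplier_ring N \<zeta> = {x. \<forall>m \<in> power_span N \<zeta>. x * m \<in> power_span N \<zeta>}"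

lemma power_spanI: "x = (\<Sum>j<N. of_int (a j) * \<zeta> ^ j) \<Longrightarrow> x \<in> power_span N \<zeta>"
  unfolding power_span_def by (rule range_eqI)

lemma power_span_add: "x \<in> power_span N \<zeta> \<Longrightarrow> y \<in> power_span N \<zeta> \<Longrightarrow> x + y \<in> power_span N \<zeta>"
proof -
  assume "x \<in> power_span N \<zeta>" "y \<in> power_span N \<zeta>"
  then obtain a b where "x = (\<Sum>j<N. of_int (a j) * \<zeta> ^ j)" "y = (\<Sum>j<N. of_int (b j) * \<zeta> ^ j)"
    unfolding power_span_def by blast
  then have "x + y = (\<Sum>j<N. of_int (a j + b j) * \<zeta> ^ j)"
    by (simp add: sum.distrib algebra_simps)
  then show ?thesis by (rule power_spanI)
qed

lemma power_span_uminus: "x \<in> power_span N \<zeta> \<Longrightarrow> - x \<in> power_span N \<zeta>"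
proof -
  assume "x \<in> power_span N \<zeta>"
  then obtain a where "x = (\<Sum>j<N. of_int (a j) * \<zeta> ^ j)"
    unfolding power_span_def by blast
  then have "- x = (\<Sum>j<N. of_int (- a j) * \<zeta> ^ j)"
    by (simp add: sum_negf)
  then show ?thesis by (rule power_spanI)
qed

lemma power_span_zero: "0 \<in> power_span N \<zeta>"
  by (rule power_spanI[of _ "\<lambda>_. 0"]) simp

lemma power_mem_power_span: "i < N \<Longrightarrow> \<zeta> ^ i \<in> power_span N \<zeta>"
proof -
  assume i: "i < N"
  have "(\<Sum>j<N. of_int (if j = i then 1 else 0) * \<zeta> ^ j) = (\<Sum>j<N. if j = i then \<zeta> ^ j else 0)"
    by (rule sum.cong) auto
  also have "\<dots> = \<zeta> ^ i" using i by simp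
  finally show ?thesis
    by (intro power_spanI[of _ "\<lambda>j. if j = i then 1 else 0"]) (rule sym)
qed

lemma multiplier_ring_add:
  "x \<in> multiplier_ring N \<zeta> \<Longrightarrow> y \<in> multiplier_ring N \<zeta> \<Longrightarrow> x + y \<in> multiplier_ring N \<zeta>"
  unfolding multiplier_ring_def by (auto simp: distrib_right intro: power_span_add)

lemma multiplier_ring_mult:
  "x \<in> multiplier_ring N \<zeta> \<Longrightarrow> y \<in> multiplier_ring N \<zeta> \<Longrightarrow> x * y \<in> multiplier_ring N \<zeta>"
  unfolding multiplier_ring_def by (auto simp: mult.assoc)

lemma multiplier_ring_uminus: "x \<in> multiplier_ring N \<zeta> \<Longrightarrow> - x \<in> multiplier_ring N \<zeta>"
  unfolding multiplier_ring_def by (simp add: power_span_uminus)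

lemma multiplier_ring_diff:
  "x \<in> multiplier_ring N \<zeta> \<Longrightarrow> y \<in> multiplier_ring N \<zeta> \<Longrightarrow> x - y \<in> multiplier_ring N \<zeta>"
  using multiplier_ring_add[of x N \<zeta> "- y"] multiplier_ring_uminus[of y N \<zeta>] by simp

lemma multiplier_ring_zero: "0 \<in> multiplier_ring N \<zeta>"
  unfolding multiplier_ring_def by (auto intro: power_span_zero)

lemma multiplier_ring_one: "1 \<in> multiplier_ring N \<zeta>"
  unfolding multiplier_ring_def by auto

lemma multiplier_ring_sum:
  "(\<And>i. i \<in> I \<Longrightarrow> f i \<in> multiplier_ring N \<zeta>) \<Longrightarrow> sum f I \<in> multiplier_ring N \<zeta>"
  by (induction I rule: infinite_finite_induct) (auto intro: multiplier_ring_zero multiplier_ring_add)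

lemma multiplier_ring_power: "x \<in> multiplier_ring N \<zeta> \<Longrightarrow> x ^ k \<in> multiplier_ring N \<zeta>"
  by (induction k) (auto intro: multiplier_ring_one multiplier_ring_mult)

text \<open>Since \<open>\<zeta> ^ N = 1\<close>, multiplication by \<zeta> shifts the coefficients
  cyclically; \<open>b\<close> is the shifted sequence, with the top coefficient \<open>a M\<close>
  wrapped round to position 0.\<close>

lemma root_mem_multiplier_ring:
  assumes "\<zeta> ^ N = 1" "N > 0"
  shows "\<zeta> \<in> multiplier_ring N \<zeta>"
  unfolding multiplier_ring_def
proof (intro CollectI ballI)
  fix m assume "m \<in> power_span N \<zeta>"
  then obtain a where a: "m = (\<Sum>j<N. of_int (a j) * \<zeta> ^ j)"
    unfolding power_span_def by blast
  obtain M where N: "N = Suc M" using \<open>N > 0\<close> gr0_implies_Suc by blast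
  define b where "b j = (case j of 0 \<Rightarrow> a M | Suc i \<Rightarrow> a i)" for j
  have "\<zeta> * m = (\<Sum>j<N. of_int (a j) * \<zeta> ^ Suc j)"
    unfolding a sum_distrib_left by (rule sum.cong) auto
  also have "\<dots> = (\<Sum>j<M. of_int (a j) * \<zeta> ^ Suc j) + of_int (a M)"
    using assms(1) unfolding N by simp
  also have "\<dots> = (\<Sum>j<N. of_int (b j) * \<zeta> ^ j)"
    unfolding N sum.lessThan_Suc_shift by (simp add: b_def)
  finally show "\<zeta> * m \<in> power_span N \<zeta>" by (rule power_spanI)
qed

text \<open>Multiplication by an element of the ring is an integer matrix on the powers of \<open>\<zeta>\<close>, so the
  element is a root of a monic integer characteristic polynomial.\<close>
lemma algebraic_int_multiplier_ring:
  assumes "x \<in> multiplier_ring N \<zeta>" "N > 0"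
  shows "algebraic_int x"
proof -
  have "\<exists>a::nat \<Rightarrow> int. x * \<zeta> ^ i = (\<Sum>j<N. of_int (a j) * \<zeta> ^ j)" if "i < N" for i
    using assms(1) power_mem_power_span[OF that, of \<zeta>]
    unfolding multiplier_ring_def power_span_def by blast
  then obtain a :: "nat \<Rightarrow> nat \<Rightarrow> int"
    where a: "\<And>i. i < N \<Longrightarrow> x * \<zeta> ^ i = (\<Sum>j<N. of_int (a i j) * \<zeta> ^ j)" by metis
  define B where "B = mat N N (\<lambda>(i, j). a i j)"
  define C where "C = map_mat (of_int :: int \<Rightarrow> complex) B"
  define v where "v = vec N (\<lambda>i. \<zeta> ^ i)"
  have C: "C \<in> carrier_mat N N" and B: "B \<in> carrier_mat N N" unfolding C_def B_def by auto
  have "eigenvector C v x" unfolding eigenvector_def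
  proof (intro conjI)
    show "v \<in> carrier_vec (dim_row C)" using C unfolding v_def by auto
    have "v $ 0 = 1" unfolding v_def using assms(2) by simp
    then show "v \<noteq> 0\<^sub>v (dim_row C)" using C assms(2) by auto
    show "C *\<^sub>v v = x \<cdot>\<^sub>v v"
      by (rule eq_vecI)
        (auto simp: C_def B_def v_def a scalar_prod_def atLeast0LessThan)
  qed
  then have "poly (char_poly C) x = 0"
    using eigenvalue_root_char_poly[OF C] unfolding eigenvalue_def by blast
  moreover have "char_poly C = map_poly of_int (char_poly B)"
    unfolding C_def by (rule of_int_hom.char_poly_hom[OF B])
  ultimately have "poly (map_poly of_int (char_poly B)) x = 0" by simp
  moreover have "lead_coeff (char_poly B) = 1" using degree_monic_char_poly[OF B] by simp
  ultimately show ?thesis unfolding algebraic_int_altdef_ipoly by blast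
qed

lemma rational_multiplier_ring_Ints:
  "x \<in> multiplier_ring N \<zeta> \<Longrightarrow> N > 0 \<Longrightarrow> x \<in> \<rat> \<Longrightarrow> x \<in> \<int>"
  using algebraic_int_multiplier_ring rational_algebraic_int_is_int by blast

section \<open>Traces, eigenvalues and permutation matrices\<close>

lemma sum_diag_mult_comm:
  assumes "A \<in> carrier_mat n m" "B \<in> carrier_mat m n"
  shows "(\<Sum>i<n. (A * B) $$ (i, i)) = (\<Sum>i<m. (B * A) $$ (i, i) :: 'b :: comm_semiring_0)"
proof -
  have "(\<Sum>i<n. (A * B) $$ (i, i)) = (\<Sum>i<n. \<Sum>j<m. A $$ (i, j) * B $$ (j, i))"
    using assms by (intro sum.cong) (auto simp: scalar_prod_def atLeast0LessThan)
  also have "\<dots> = (\<Sum>j<m. \<Sum>i<n. B $$ (j, i) * A $$ (i, j))"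
    by (subst sum.swap) (simp add: mult.commute)
  also have "\<dots> = (\<Sum>i<m. (B * A) $$ (i, i))"
    using assms by (intro sum.cong) (auto simp: scalar_prod_def atLeast0LessThan)
  finally show ?thesis .
qed

text \<open>By Schur decomposition the matrix is similar to an upper triangular one, whose diagonal
  entries are roots of the characteristic polynomial; similarity preserves the trace.\<close>

lemma trace_eq_sum_eigenvalues:
  fixes A :: "complex mat"
  assumes A: "A \<in> carrier_mat n n"
  shows "\<exists>f. (\<forall>i<n. eigenvalue A (f i)) \<and> (\<Sum>i<n. A $$ (i, i)) = (\<Sum>i<n. f i)"
proof -
  obtain es where "char_poly A = (\<Prod>a\<leftarrow>es. [:- a, 1:])"
    using char_poly_factorized[OF A] by blast
  from schur_decomposition_exists[OF A this] obtain B
    where B: "B \<in> carrier_mat n n" "upper_triangular B" "similar_mat A B" by blast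
  obtain P Q where "similar_mat_wit A B P Q" using B(3) unfolding similar_mat_def by blast
  note w = similar_mat_witD2[OF A this]
  have "eigenvalue A (B $$ (i, i))" if "i < n" for i
  proof -
    have "char_poly A = (\<Prod>a\<leftarrow>diag_mat B. [:- a, 1:])"
      using char_poly_upper_triangular[OF B(1,2)] char_poly_similar[OF B(3)] by simp
    moreover have "B $$ (i, i) \<in> set (diag_mat B)"
      using that B(1) by (auto simp: diag_mat_def)
    then have "0 \<in> set (map (\<lambda>a. B $$ (i, i) - a) (diag_mat B))"
      by (auto simp: image_iff)
    ultimately have "poly (char_poly A) (B $$ (i, i)) = 0"
      by (simp add: poly_prod_list prod_list_zero_iff o_def)
    then show ?thesis using eigenvalue_root_char_poly[OF A] by simp
  qed
  moreover have "(\<Sum>i<n. A $$ (i, i)) = (\<Sum>i<n. B $$ (i, i))"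
  proof -
    have "(\<Sum>i<n. A $$ (i, i)) = (\<Sum>i<n. (P * (B * Q)) $$ (i, i))"
      using assoc_mult_mat[OF w(6,5,7)] w(3) by simp
    also have "\<dots> = (\<Sum>i<n. (B * Q * P) $$ (i, i))"
      using w(5-7) by (intro sum_diag_mult_comm) auto
    also have "B * Q * P = B"
      using assoc_mult_mat[OF w(5,7,6)] w(2,5) by simp
    finally show ?thesis .
  qed
  ultimately show ?thesis by (intro exI[of _ "\<lambda>i. B $$ (i, i)"]) simp
qed

text \<open>If \<open>\<Phi>\<^sup>2 = c \<Phi>\<close> and the permutation matrix \<open>P\<close> commutes with \<open>\<Phi>\<close>, then
  \<open>Y = \<Phi> P\<close> satisfies \<open>Y\<^bsup>N+1\<^esup> = c\<^sup>N Y\<close>, so its eigenvalues are \<open>0\<close> or \<open>c\<close> times a root of unity.\<close>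
lemma trace_idempotent_permutation:
  fixes \<Phi> :: "'a \<Rightarrow> 'a \<Rightarrow> real"
  assumes fin: "finite X" and bij: "bij_betw \<theta> X X"
    and N: "N > 0" "\<And>x. x \<in> X \<Longrightarrow> (\<theta> ^^ N) x = x"
    and inv: "\<And>x y. x \<in> X \<Longrightarrow> y \<in> X \<Longrightarrow> \<Phi> (\<theta> x) (\<theta> y) = \<Phi> x y"
    and idem: "\<And>x y. x \<in> X \<Longrightarrow> y \<in> X \<Longrightarrow> (\<Sum>z\<in>X. \<Phi> x z * \<Phi> z y) = c * \<Phi> x y"
    and c: "c \<noteq> 0"
  shows "complex_of_real ((\<Sum>x\<in>X. \<Phi> x (\<theta> x)) / c) \<in> multiplier_ring N (cis (2 * pi / N))"
proof -
  define v where "v = card X"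
  obtain e where e: "bij_betw e {..<v} X"
    using ex_bij_betw_nat_finite[OF fin] unfolding v_def atLeast0LessThan by blast
  have eX: "i < v \<Longrightarrow> e i \<in> X" for i using e by (auto simp: bij_betw_def)
  have bijk: "bij_betw (\<theta> ^^ k) X X" for k using bij by (rule bij_betw_funpow)
  have kX: "x \<in> X \<Longrightarrow> (\<theta> ^^ k) x \<in> X" for x k using bijk[of k] by (auto simp: bij_betw_def)
  have invk: "\<Phi> ((\<theta> ^^ k) x) ((\<theta> ^^ k) y) = \<Phi> x y" if "x \<in> X" "y \<in> X" for x y k
    using that by (induction k) (auto simp: inv kX)
  define Y where "Y = mat v v (\<lambda>(i, j). complex_of_real (\<Phi> (e i) (\<theta> (e j))))"
  have Y: "Y \<in> carrier_mat v v" unfolding Y_def by simp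
  \<comment> \<open>This is where \<Phi> and the permutation commute: shifting both arguments of the
    second factor by \<open>\<theta> ^^ k\<close> and then reindexing the sum moves the permutation
    past \<Phi>.\<close>
  have step: "(\<Sum>l<v. \<Phi> x ((\<theta> ^^ k) (e l)) * \<Phi> (e l) (\<theta> y)) = c * \<Phi> x ((\<theta> ^^ Suc k) y)"
    if "x \<in> X" "y \<in> X" for x y k
  proof -
    have "(\<Sum>l<v. \<Phi> x ((\<theta> ^^ k) (e l)) * \<Phi> (e l) (\<theta> y))
        = (\<Sum>z\<in>X. \<Phi> x ((\<theta> ^^ k) z) * \<Phi> z (\<theta> y))"
      by (rule sum.reindex_bij_betw[OF e])
    also have "\<dots> = (\<Sum>z\<in>X. \<Phi> x ((\<theta> ^^ k) z) * \<Phi> ((\<theta> ^^ k) z) ((\<theta> ^^ Suc k) y))"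
      using that kX[of y 1] invk[of _ "\<theta> y" k]
      by (intro sum.cong) (auto simp: funpow_swap1)
    also have "\<dots> = (\<Sum>z\<in>X. \<Phi> x z * \<Phi> z ((\<theta> ^^ Suc k) y))"
      by (rule sum.reindex_bij_betw[OF bijk])
    also have "\<dots> = c * \<Phi> x ((\<theta> ^^ Suc k) y)" using that kX by (intro idem) 
    finally show ?thesis .
  qed
  have pow: "Y ^\<^sub>m Suc k = mat v v (\<lambda>(i, j). complex_of_real (c ^ k * \<Phi> (e i) ((\<theta> ^^ Suc k) (e j))))" for k
  proof (induction k)
    case 0
    show ?case using Y by (simp add: Y_def)
  next
    case (Suc k)
    show ?case
    proof (rule eq_matI)
      fix i j assume "i < dim_row (mat v v (\<lambda>(i, j). complex_of_real (c ^ Suc k * \<Phi> (e i) ((\<theta> ^^ Suc (Suc k)) (e j)))))"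
        and "j < dim_col (mat v v (\<lambda>(i, j). complex_of_real (c ^ Suc k * \<Phi> (e i) ((\<theta> ^^ Suc (Suc k)) (e j)))))"
      then have ij: "i < v" "j < v" by auto
      have "(Y ^\<^sub>m Suc (Suc k)) $$ (i, j) = (Y ^\<^sub>m Suc k * Y) $$ (i, j)" by simp
      also have "\<dots> = (\<Sum>l<v. complex_of_real (c ^ k * \<Phi> (e i) ((\<theta> ^^ Suc k) (e l))) * complex_of_real (\<Phi> (e l) (\<theta> (e j))))"
        unfolding Suc unfolding Y_def using ij by (simp add: scalar_prod_def atLeast0LessThan)
      also have "\<dots> = complex_of_real (c ^ k * (\<Sum>l<v. \<Phi> (e i) ((\<theta> ^^ Suc k) (e l)) * \<Phi> (e l) (\<theta> (e j))))"
        by (simp add: sum_distrib_left mult.assoc)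
      also have "\<dots> = complex_of_real (c ^ k * (c * \<Phi> (e i) ((\<theta> ^^ Suc (Suc k)) (e j))))"
        using ij by (simp only: step[OF eX eX])
      finally show "(Y ^\<^sub>m Suc (Suc k)) $$ (i, j) =
         mat v v (\<lambda>(i, j). complex_of_real (c ^ Suc k * \<Phi> (e i) ((\<theta> ^^ Suc (Suc k)) (e j)))) $$ (i, j)"
        using ij by (simp add: mult.assoc mult.left_commute)
    qed (use Y in auto)
  qed
  \<comment> \<open>On \<open>X\<close> the map \<open>\<theta> ^^ Suc N\<close> is \<theta> again,
    so the formula for the powers returns to \<open>Y\<close>.\<close>
  have powN: "Y ^\<^sub>m Suc N = complex_of_real (c ^ N) \<cdot>\<^sub>m Y"
    unfolding pow unfolding Y_def
    by (rule eq_matI) (use N(2) eX kX[of _ 1] in \<open>simp_all add: funpow_swap1\<close>)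
  obtain f where f: "\<And>i. i < v \<Longrightarrow> eigenvalue Y (f i)" "(\<Sum>i<v. Y $$ (i, i)) = (\<Sum>i<v. f i)"
    using trace_eq_sum_eigenvalues[OF Y] by blast
  define \<zeta> where "\<zeta> = cis (2 * pi / N)"
  have "cis (2 * pi / N) ^ N = 1"
    unfolding DeMoivre using N(1) by simp
  then have \<zeta>: "\<zeta> \<in> multiplier_ring N \<zeta>"
    unfolding \<zeta>_def using root_mem_multiplier_ring N(1) by blast
  have "f i / c \<in> multiplier_ring N \<zeta>" if i: "i < v" for i
  proof (cases "f i = 0")
    case True
    then show ?thesis by (simp add: multiplier_ring_zero)
  next
    case False
    obtain w where w: "eigenvector Y w (f i)" using f(1)[OF i] unfolding eigenvalue_def by blast
    then have wc: "w \<in> carrier_vec v" "w \<noteq> 0\<^sub>v v" "Y *\<^sub>v w = f i \<cdot>\<^sub>v w"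
      using Y unfolding eigenvector_def by auto
    have "f i ^ Suc N \<cdot>\<^sub>v w = (complex_of_real (c ^ N) \<cdot>\<^sub>m Y) *\<^sub>v w"
      using eigenvector_pow[OF Y w, of "Suc N"] powN by simp
    also have "\<dots> = complex_of_real (c ^ N) \<cdot>\<^sub>v (f i \<cdot>\<^sub>v w)"
      unfolding wc(3)[symmetric] using Y wc(1)
      by (intro eq_vecI) (auto simp: scalar_prod_def sum_distrib_left mult.assoc)
    finally have eq: "f i ^ Suc N \<cdot>\<^sub>v w = (complex_of_real (c ^ N) * f i) \<cdot>\<^sub>v w"
      by (simp add: smult_smult_assoc)
    obtain j where j: "j < v" "w $ j \<noteq> 0" using wc(1,2) by (auto simp: vec_eq_iff)
    have "f i ^ Suc N * w $ j = (complex_of_real (c ^ N) * f i) * w $ j"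
      using arg_cong[OF eq, of "\<lambda>u. u $ j"] j wc(1) by simp
    then have "f i ^ N = complex_of_real (c ^ N)" using j False by simp
    then have "(f i / c) ^ N = 1" using c by (simp add: power_divide)
    then have "f i / c \<in> (\<lambda>k. cis (2 * pi * real k / real N)) ` {..<N}"
      using bij_betw_imp_surj_on[OF bij_betw_roots_unity[OF N(1)]] by simp
    then obtain k where "f i / c = cis (2 * pi * real k / real N)" by blast
    also have "\<dots> = \<zeta> ^ k" unfolding \<zeta>_def DeMoivre by (simp add: mult.commute)
    finally show ?thesis using multiplier_ring_power[OF \<zeta>] by simp
  qed
  then have "(\<Sum>i<v. f i / c) \<in> multiplier_ring N \<zeta>" by (intro multiplier_ring_sum) auto
  also have "(\<Sum>i<v. f i / c) = (\<Sum>i<v. Y $$ (i, i)) / c"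
    unfolding f(2) by (simp add: sum_divide_distrib)
  also have "(\<Sum>i<v. Y $$ (i, i)) = complex_of_real (\<Sum>i<v. \<Phi> (e i) (\<theta> (e i)))"
    unfolding Y_def by simp
  also have "(\<Sum>i<v. \<Phi> (e i) (\<theta> (e i))) = (\<Sum>x\<in>X. \<Phi> x (\<theta> x))"
    by (rule sum.reindex_bij_betw[OF e])
  finally show ?thesis unfolding \<zeta>_def by simp
qed

lemma bij_betw_funpow_identity:
  assumes "finite X" "bij_betw \<theta> X X"
  shows "\<exists>N>0. \<forall>x\<in>X. (\<theta> ^^ N) x = x"
proof -
  \<comment> \<open>Outside \<open>X\<close> nothing is known about \<theta>, whereas
    \<open>permutes\<close> demands the identity there.\<close>
  define \<tau> where "\<tau> x = (if x \<in> X then \<theta> x else x)" for x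
  have "bij_betw \<tau> X X" using assms(2) by (simp add: \<tau>_def cong: bij_betw_cong)
  then have "\<tau> permutes X" by (rule bij_imp_permutes) (simp add: \<tau>_def)
  then have "permutation \<tau>" using assms(1) permutation_permutes by blast
  then obtain N where N: "\<tau> ^^ N = id" "N > 0" using permutation_is_nilpotent by blast
  have "(\<theta> ^^ k) x \<in> X \<and> (\<theta> ^^ k) x = (\<tau> ^^ k) x" if "x \<in> X" for x k
    using that assms(2) by (induction k) (auto simp: \<tau>_def bij_betw_def)
  then have "\<forall>x\<in>X. (\<theta> ^^ N) x = x" using N(1) by simp
  then show ?thesis using N(2) by blast
qed

section \<open>Integrality conditions on the order\<close>

lemma of_nat_divide_Ints_imp_dvd:
  assumes "real a / real b \<in> \<int>" "b > 0"
  shows "b dvd a"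
proof -
  obtain k where "real a / real b = of_int k" using assms(1) by (elim Ints_cases)
  then have "real a = of_int k * real b" using assms(2) by (simp add: field_simps)
  then have "of_int (int a) = (of_int (k * int b) :: real)" by simp
  then have "int a = k * int b" by (simp only: of_int_eq_iff)
  then have "int b dvd int a" by simp
  then show ?thesis by simp
qed

lemma of_int_divide_Ints_imp_dvd:
  assumes "(of_int a :: real) / of_int b \<in> \<int>" "b > 0"
  shows "b dvd a"
proof -
  obtain k where "(of_int a :: real) / of_int b = of_int k" using assms(1) by (elim Ints_cases)
  then have "(of_int a :: real) = of_int (k * b)" using assms(2) by (simp add: field_simps)
  then have "a = k * b" by (simp only: of_int_eq_iff)
  then show ?thesis by simp
qed

section \<open>Divisibility conditions that exclude every order\<close>

lemma octagon_parameters_aux: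
  fixes s t :: nat
  assumes "s dvd t + 1" "t dvd s + 1" "2 \<le> s" "s \<le> t"
  shows "s = 2 \<and> t = 3"
proof -
  have "t \<le> s + 1" using assms(2) by (intro dvd_imp_le) auto
  then consider "t = s" | "t = s + 1" using assms(4) by linarith
  then show ?thesis
  proof cases
    case 1
    then have "s dvd 1" using assms(1) by (simp only: dvd_add_right_iff[OF dvd_refl])
    then show ?thesis using assms(3) by simp
  next
    case 2
    then have "s dvd s + 2" using assms(1) by simp
    then have "s dvd 2" by (simp only: dvd_add_right_iff[OF dvd_refl])
    then have "s \<le> 2" by (intro dvd_imp_le) auto
    then show ?thesis using assms(3) 2 by simp
  qed
qed

lemma octagon_parameters:
  fixes s t :: nat
  assumes "2 \<le> s" "2 \<le> t" and dvd: "2 * s * t * (s + t) dvd (1 + s) * (1 + t) * (1 + s\<^sup>2 * t\<^sup>2)"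
  shows False
proof -
  have *: "s' dvd t' + 1"
    if "s' dvd (1 + s') * (1 + t') * (1 + s'\<^sup>2 * t'\<^sup>2)" for s' t' :: nat
  proof -
    \<comment> \<open>Both \<open>1 + s'\<close> and the last factor are 1 modulo \<open>s'\<close>,
      so \<open>s'\<close> has to divide the remaining factor \<open>1 + t'\<close>.\<close>
    have "coprime s' (1 + s'\<^sup>2 * t'\<^sup>2)"
    proof (rule coprimeI)
      fix c assume c: "c dvd s'" "c dvd 1 + s'\<^sup>2 * t'\<^sup>2"
      then have "c dvd s'\<^sup>2 * t'\<^sup>2" by (simp add: power2_eq_square)
      with c(2) show "is_unit c" by (simp only: dvd_add_left_iff)
    qed
    moreover have "coprime s' (1 + s')" by simp
    ultimately have "s' dvd 1 + t'" using that
      by (simp only: coprime_dvd_mult_left_iff coprime_dvd_mult_right_iff)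
    then show ?thesis by (simp add: add.commute)
  qed
  have "s dvd (1 + s) * (1 + t) * (1 + s\<^sup>2 * t\<^sup>2)"
    using dvd by (rule dvd_trans[rotated]) simp
  then have st: "s dvd t + 1" by (rule *)
  have "t dvd (1 + s) * (1 + t) * (1 + s\<^sup>2 * t\<^sup>2)"
    using dvd by (rule dvd_trans[rotated]) simp
  then have "t dvd (1 + t) * (1 + s) * (1 + t\<^sup>2 * s\<^sup>2)" by (simp only: mult.commute)
  then have ts: "t dvd s + 1" by (rule *)
  have "s = 2 \<and> t = 3 \<or> t = 2 \<and> s = 3"
    using octagon_parameters_aux[OF st ts] octagon_parameters_aux[OF ts st] assms(1,2) by linarith
  \<comment> \<open>For the orders 2 and 3 the divisor is 60 and the dividend is
    \<open>3 * 4 * 37 = 444\<close>.\<close>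
  then show False using dvd by auto
qed

text \<open>Vieta jumping: with \<open>s \<le> t\<close> the equation is quadratic in \<open>t\<close> with second root
  \<open>(1 + s)\<^sup>2 / t\<close>, which is smaller unless \<open>t \<le> s + 1\<close>.\<close>
lemma vieta_descent:
  fixes s t k :: nat
  assumes "0 < s" "0 < t" "(1 + s + t)\<^sup>2 = k * s * t"
  shows "k \<in> {5, 6, 8, 9}"
  using assms
proof (induction "s + t" arbitrary: s t rule: less_induct)
  case less
  \<comment> \<open>The equation is symmetric, so an ordered pair with the same sum, on which the
    induction runs, is enough.\<close>
  have main: ?case if le: "a \<le> b" and pos: "0 < a" "0 < b" and eq: "(1 + a + b)\<^sup>2 = k * a * b"
    and ab: "a + b = s + t" for a b
  proof -
    consider "b = a" | "b = a + 1" | "a + 2 \<le> b" using le by linarith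
    then show ?thesis
    proof cases
      case 1
      \<comment> \<open>This case leaves only \<open>a = 1\<close> and \<open>k = 9\<close>.\<close>
      have "a dvd (1 + a + a)\<^sup>2" using eq 1 by simp
      also have "(1 + a + a)\<^sup>2 = 1 + a * (4 + 4 * a)" by (simp add: power2_eq_square distrib_left distrib_right)
      finally have "a dvd 1" by (simp only: dvd_add_left_iff[OF dvd_triv_left])
      then show ?thesis using eq 1 by (simp add: power2_eq_square)
    next
      case 2
      have "(a + 1) * (k * a) = (a + 1) * (4 * (a + 1))"
        using eq 2 by (simp add: power2_eq_square algebra_simps)
      then have ka: "k * a = 4 * (a + 1)" by (simp only: mult_cancel1) simp
      then have "a dvd 4 * a + 4" by (intro dvdI[of _ _ k]) (simp add: ac_simps)
      then have "a dvd 4" by (simp only: dvd_add_right_iff[OF dvd_triv_right])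
      then have "a \<le> 4" by (intro dvd_imp_le) auto
      \<comment> \<open>The divisors 1, 2 and 4 of 4 give \<open>k = 8\<close>, \<open>k = 6\<close>
        and \<open>k = 5\<close>.\<close>
      then have "a = 1 \<or> a = 2 \<or> a = 3 \<or> a = 4" using pos by linarith
      then show ?thesis using ka \<open>a dvd 4\<close> by auto
    next
      case 3
      have "(1 + a)\<^sup>2 + b * (2 * (1 + a) + b) = b * (k * a)"
        using eq by (simp add: power2_eq_square algebra_simps)
      then have "b dvd (1 + a)\<^sup>2 + b * (2 * (1 + a) + b)" by (simp only: dvd_triv_left)
      then have "b dvd (1 + a)\<^sup>2" by (simp only: dvd_add_left_iff[OF dvd_triv_left])
      then obtain c where c: "(1 + a)\<^sup>2 = b * c" by blast
      have "b * (c + 2 * (1 + a) + b) = b * (k * a)"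
        using \<open>(1 + a)\<^sup>2 + b * (2 * (1 + a) + b) = b * (k * a)\<close> unfolding c
        by (simp add: algebra_simps)
      then have ka: "k * a = c + 2 * (1 + a) + b" using pos(2) by (simp only: mult_cancel1) simp
      have "0 < (1 + a)\<^sup>2" by simp
      then have "0 < c" unfolding c by simp
      have "(1 + a + c)\<^sup>2 = (1 + a)\<^sup>2 + 2 * (1 + a) * c + c * c"
        by (simp add: power2_eq_square algebra_simps)
      also have "\<dots> = k * a * c" unfolding c ka by (simp add: algebra_simps)
      finally have eq': "(1 + a + c)\<^sup>2 = k * a * c" .
      \<comment> \<open>Here \<open>1 + a < b\<close>, so the second root \<open>c\<close> is
        smaller than \<open>b\<close> and the pair \<open>a\<close>, \<open>c\<close> has a smaller
        sum.\<close>
      have "b * c < b * b"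
        unfolding c[symmetric] power2_eq_square using 3 by (intro mult_strict_mono) auto
      then have "c < b" using pos by simp
      then show ?thesis using less.hyps[of a c] ab pos \<open>0 < c\<close> eq' by simp
    qed
  qed
  show ?case
  proof (cases "s \<le> t")
    case True
    then show ?thesis using main[of s t] less.prems by simp
  next
    case False
    then show ?thesis using main[of t s] less.prems by (simp add: ac_simps)
  qed
qed

text \<open>Here \<open>x = s + t\<close>, and \<open>x < 88\<close> since \<open>3 x\<^sup>2 \<le> 4 D\<close> while \<open>D\<close> divides a resultant that is at
  most \<open>5733\<close>.\<close>
lemma hexagon_finite_check:
  "\<forall>k \<in> set [5, 6, 8, 9]. \<forall>x \<in> set [4..<88]. k dvd (1 + x)\<^sup>2 \<longrightarrow>
     x\<^sup>2 - (1 + x)\<^sup>2 div k dvd (k\<^sup>2 + k + 1) * (k\<^sup>2 + 9 - 3 * k) \<longrightarrow>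
     (1 + x)\<^sup>2 div k + 4 < 2 * (x::nat)"
  by (simp add: upt_rec_numeral)

text \<open>\<open>k\<^sup>2 + k + 1\<close> and \<open>k\<^sup>2 - 3 k + 9\<close> are the resultants of \<open>(k - 1) \<sigma>\<^sup>2 - 2 \<sigma> - 1\<close> with
  \<open>\<sigma>\<^sup>2 + \<sigma> + 1\<close> and \<open>\<sigma>\<^sup>2 - \<sigma> + 1\<close>.\<close>
lemma hexagon_resultant:
  fixes D \<sigma> k :: int
  assumes 1: "D dvd (\<sigma>\<^sup>2 + \<sigma> + 1) * (\<sigma>\<^sup>2 - \<sigma> + 1)" and 2: "D dvd (k - 1) * \<sigma>\<^sup>2 - 2 * \<sigma> - 1"
  shows "D dvd (k\<^sup>2 + k + 1) * (k\<^sup>2 - 3 * k + 9)"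
proof -
  define P where "P = \<sigma>\<^sup>2 + \<sigma> + 1"
  define Q where "Q = \<sigma>\<^sup>2 - \<sigma> + 1"
  define g where "g = (k - 1) * \<sigma>\<^sup>2 - 2 * \<sigma> - 1"
  \<comment> \<open>\<open>u\<close>, \<open>w\<close>, \<open>\<alpha>\<close> and
    \<open>\<beta>\<close> are the cofactors of the Bezout identities 3 and 4, which write the
    resultants as combinations of \<open>P\<close>, \<open>g\<close> and of \<open>Q\<close>,
    \<open>g\<close>.\<close>
  define u where "u = (k + 1) * \<sigma> + 1"
  define w where "w = - (k - 3) * \<sigma> - 3"
  define \<alpha> where "\<alpha> = (k + 1)\<^sup>2 - (k - 1) * u"
  define \<beta> where "\<beta> = (k - 3)\<^sup>2 - (k - 1) * w"
  have 3: "k\<^sup>2 + k + 1 = P * \<alpha> + g * u"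
    unfolding P_def g_def \<alpha>_def u_def by (simp add: power2_eq_square algebra_simps)
  have 4: "k\<^sup>2 - 3 * k + 9 = Q * \<beta> + g * w"
    unfolding Q_def g_def \<beta>_def w_def by (simp add: power2_eq_square algebra_simps)
  have "(k\<^sup>2 + k + 1) * (k\<^sup>2 - 3 * k + 9) =
      (P * Q) * (\<alpha> * \<beta>) + g * (u * (Q * \<beta> + g * w) + P * \<alpha> * w)"
    unfolding 3 4 by (simp only: distrib_left distrib_right ac_simps)
  moreover have "D dvd P * Q" "D dvd g" using assms unfolding P_def Q_def g_def by auto
  ultimately show ?thesis by simp
qed

text \<open>Modulo \<open>D\<close> one has \<open>q = \<sigma>^2\<close>. Hence condition 1 makes
  \<open>\<sigma>^4 + \<sigma>^2 + 1\<close> vanish modulo \<open>D\<close>, and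
  \<open>(1 + \<sigma>)^2 = k * q\<close> makes
  \<open>(k - 1) * \<sigma>^2 - 2 * \<sigma> - 1\<close> vanish; eliminating \<sigma> bounds
  \<open>D\<close> in terms of \<open>k\<close>.\<close>

lemma hexagon_parameters:
  fixes s t :: nat
  defines "D \<equiv> (int s)\<^sup>2 + int s * int t + (int t)\<^sup>2"
  assumes st: "2 \<le> s" "2 \<le> t"
    and 1: "D dvd ((int s)\<^sup>2 - 1) * ((int t)\<^sup>2 - 1)"
    and 2: "int s * int t * D\<^sup>2 dvd
      ((1 + int s) * (1 + int t) * ((1 + int s * int t) * (int s + int t) - int s * int t))\<^sup>2"
  shows False
proof -
  define \<sigma> where "\<sigma> = int s + int t"
  define q where "q = int s * int t"
  have D: "D = \<sigma>\<^sup>2 - q" unfolding D_def \<sigma>_def q_def by (simp add: power2_eq_square algebra_simps)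
  have "1 + q + q\<^sup>2 = ((int s)\<^sup>2 - 1) * ((int t)\<^sup>2 - 1) + D"
    unfolding D_def q_def by (simp add: power2_eq_square algebra_simps)
  then have Dq: "D dvd 1 + q + q\<^sup>2" using 1 by simp
  have cop: "coprime (int s) (int t)"
  proof (rule coprimeI)
    fix c assume c: "c dvd int s" "c dvd int t"
    then have "c dvd D" unfolding D_def by (simp add: power2_eq_square)
    then have "c dvd 1 + (q + q\<^sup>2)" using Dq dvd_trans[of c D] by (simp add: add.assoc)
    moreover have "c dvd q + q\<^sup>2" using c unfolding q_def by (auto simp: power2_eq_square)
    ultimately show "is_unit c" by (simp only: dvd_add_left_iff)
  qed
  \<comment> \<open>Modulo \<open>a\<close> the product inside the square is
    \<open>(1 + b) * b\<close>, where \<open>b\<close> is invertible, and \<open>1 + a + b\<close>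
    reduces to \<open>1 + b\<close>.\<close>
  have *: "a dvd (1 + a + b)\<^sup>2"
    if ab: "coprime a b" "a dvd ((1 + a) * (1 + b) * ((1 + a * b) * (a + b) - a * b))\<^sup>2" for a b :: int
  proof -
    define M where "M = (1 + b) * (1 + a * b + b\<^sup>2 - b + a + b + a\<^sup>2 * b + a * b\<^sup>2 - a * b)"
    have "(1 + a) * (1 + b) * ((1 + a * b) * (a + b) - a * b) = a * M + (1 + b) * b"
      unfolding M_def by (simp add: power2_eq_square algebra_simps)
    moreover have "(a * M + (1 + b) * b)\<^sup>2 = a * (a * M\<^sup>2 + 2 * M * (1 + b) * b) + b\<^sup>2 * (1 + b)\<^sup>2"
      by (simp add: power2_eq_square algebra_simps)
    ultimately have "a dvd b\<^sup>2 * (1 + b)\<^sup>2" using ab(2) by (simp only: dvd_add_right_iff[OF dvd_triv_left])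
    then have "a dvd (1 + b)\<^sup>2" using ab(1) by (simp add: coprime_dvd_mult_right_iff)
    moreover have "(1 + a + b)\<^sup>2 = a * (a + 2 * (1 + b)) + (1 + b)\<^sup>2"
      by (simp add: power2_eq_square algebra_simps)
    ultimately show ?thesis by simp
  qed
  have "int s dvd (1 + \<sigma>)\<^sup>2"
    using *[OF cop] dvd_trans[OF _ 2, of "int s"] unfolding \<sigma>_def by (simp add: add.assoc)
  moreover have "int t dvd (1 + \<sigma>)\<^sup>2"
    using *[of "int t" "int s"] cop dvd_trans[OF _ 2, of "int t"] unfolding \<sigma>_def
    by (simp add: ac_simps)
  ultimately have "q dvd (1 + \<sigma>)\<^sup>2" unfolding q_def using cop by (rule divides_mult)
  then have "int (s * t) dvd int ((1 + s + t)\<^sup>2)" unfolding q_def \<sigma>_def by (simp add: ac_simps)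
  then have "s * t dvd (1 + s + t)\<^sup>2" by (simp only: of_nat_dvd_iff)
  then obtain k where k: "(1 + s + t)\<^sup>2 = k * s * t" by (metis dvdE mult.commute mult.left_commute)
  have k4: "k \<in> {5, 6, 8, 9}" using vieta_descent[OF _ _ k] st by simp
  have "int ((1 + s + t)\<^sup>2) = int (k * s * t)" using k by simp
  then have kq: "(1 + \<sigma>)\<^sup>2 = int k * q" unfolding \<sigma>_def q_def by (simp add: ac_simps)
  have "D dvd (int k - 1) * \<sigma>\<^sup>2 - 2 * \<sigma> - 1"
  proof -
    have "(int k - 1) * \<sigma>\<^sup>2 - 2 * \<sigma> - 1 = int k * \<sigma>\<^sup>2 - (1 + \<sigma>)\<^sup>2"
      by (simp add: power2_eq_square algebra_simps)
    also have "\<dots> = int k * D" unfolding kq D by (simp add: algebra_simps)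
    finally show ?thesis by simp
  qed
  moreover have "D dvd (\<sigma>\<^sup>2 + \<sigma> + 1) * (\<sigma>\<^sup>2 - \<sigma> + 1)"
  proof -
    have "(\<sigma>\<^sup>2 + \<sigma> + 1) * (\<sigma>\<^sup>2 - \<sigma> + 1) = (\<sigma>\<^sup>2)\<^sup>2 + \<sigma>\<^sup>2 + 1"
      by (simp add: power2_eq_square algebra_simps)
    also have "\<dots> = (D + q)\<^sup>2 + (D + q) + 1" using D by simp
    also have "\<dots> = D * (D + 2 * q + 1) + (1 + q + q\<^sup>2)"
      by (simp add: power2_eq_square algebra_simps)
    finally show ?thesis using Dq by simp
  qed
  ultimately have R: "D dvd (int k ^ 2 + int k + 1) * (int k ^ 2 - 3 * int k + 9)"
    by (intro hexagon_resultant)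
  have R': "(int k ^ 2 + int k + 1) * (int k ^ 2 - 3 * int k + 9) = int ((k\<^sup>2 + k + 1) * (k\<^sup>2 + 9 - 3 * k))"
    and R'': "(int k ^ 2 + int k + 1) * (int k ^ 2 - 3 * int k + 9) \<in> {1..5733}"
    using k4 by auto
  have "D \<le> 5733" using zdvd_imp_le[OF R] R'' by auto
  moreover have "4 * D = 3 * \<sigma>\<^sup>2 + (int s - int t)\<^sup>2"
    unfolding D_def \<sigma>_def by (simp add: power2_eq_square algebra_simps)
  ultimately have "\<sigma>\<^sup>2 \<le> 7644" using zero_le_power2[of "int s - int t"] by linarith
  then have "\<sigma>\<^sup>2 < 88\<^sup>2" by simp
  then have "\<sigma> < 88" by (rule power_less_imp_less_base) simp
  then have x: "s + t < 88" unfolding \<sigma>_def by simp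
  have q: "(1 + (s + t))\<^sup>2 div k = s * t"
    using k k4 by (auto simp: ac_simps)
  have "int ((s + t)\<^sup>2 - s * t) = D"
    unfolding D_def by (subst of_nat_diff) (auto simp: power2_eq_square algebra_simps)
  then have "int ((s + t)\<^sup>2 - s * t) dvd int ((k\<^sup>2 + k + 1) * (k\<^sup>2 + 9 - 3 * k))"
    using R unfolding R' by (simp only:)
  then have "(s + t)\<^sup>2 - s * t dvd (k\<^sup>2 + k + 1) * (k\<^sup>2 + 9 - 3 * k)"
    by (simp only: of_nat_dvd_iff)
  then have D': "(s + t)\<^sup>2 - (1 + (s + t))\<^sup>2 div k dvd (k\<^sup>2 + k + 1) * (k\<^sup>2 + 9 - 3 * k)"
    unfolding q .
  have "k \<in> set [5, 6, 8, 9]" using k4 by simp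
  moreover have "s + t \<in> set [4..<88]" unfolding set_upt using x st by simp
  moreover have "k dvd (1 + (s + t))\<^sup>2" using k by (simp add: add.assoc mult.assoc)
  ultimately have "(1 + (s + t))\<^sup>2 div k + 4 < 2 * (s + t)"
    using D' by (rule hexagon_finite_check[rule_format])
  then have "s * t + 4 < 2 * (s + t)" unfolding q .
  \<comment> \<open>The inequality just obtained amounts to
    \<open>(s - 2) * (t - 2) < 0\<close>.\<close>
  moreover have "0 \<le> (int s - 2) * (int t - 2)" using st by simp
  then have "2 * (int s + int t) \<le> int s * int t + 4" by (simp add: algebra_simps)
  then have "int (2 * (s + t)) \<le> int (s * t + 4)" by simp
  then have "2 * (s + t) \<le> s * t + 4" by (simp only: of_nat_le_iff)
  ultimately show False by simp
qed

text \<open>The norm of the eigenfunction of the hexagon belonging to \<open>x = \<plusminus> \<surd>(s t)\<close>.\<close>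
lemma hexagon_norm:
  fixes S T x :: real
  assumes pos: "S > 0" "T > 0" and x: "x\<^sup>2 = S * T"
    and w1: "w1 = S - 1 + x" and w2: "w2 = x * (S - 1) - S"
  shows "1 + w1 / (S * (T + 1)) * w1 + w2 / (S\<^sup>2 * T * (T + 1)) * w2 + x / (S * T)\<^sup>2 * (x * S)
    = 2 * (1 - x + S * T) * (S + T + x) / (S * T * (T + 1))"
proof -
  have xx: "x * x = S * T" using x by (simp add: power2_eq_square)
  have nz: "S \<noteq> 0" "T \<noteq> 0" "T + 1 \<noteq> 0" using pos by auto
  have 1: "x / (S * T)\<^sup>2 * (x * S) = 1 / T"
    using nz xx by (simp add: divide_simps power2_eq_square)
  have "S * S * T * (T + 1) + S * T * (w1 * w1) + w2 * w2 + S * S * (T + 1)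
      = S * (2 * (1 - x + S * T) * (S + T + x))"
    unfolding w1 w2 by (simp add: algebra_simps xx)
  then show ?thesis unfolding 1 using nz by (simp add: divide_simps power2_eq_square) (simp add: algebra_simps)
qed

text \<open>The left side is the number of points times the eigenfunction at distance 6, divided by
  its norm \<open>c\<close>. As \<open>x^2 = S * T\<close>, the factor
  \<open>1 + S * T + (S * T)^2\<close> of the number of points splits, and
  \<open>1 - x + S * T\<close> cancels.\<close>

lemma hexagon_trace_value:
  fixes S T x :: real
  assumes pos: "S > 0" "T > 0" and x: "x\<^sup>2 = S * T"
    and c: "c = 2 * (1 - x + S * T) * (S + T + x) / (S * T * (T + 1))"
  shows "(1 + S) * (1 + S * T + (S * T)\<^sup>2) * (- x / (S * T)\<^sup>2) / c
      = - x * (1 + S) * (1 + T) * (1 + x + S * T) / (2 * S * T * (S + T + x))"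
    and "S + T + x > 0" and "c > 0"
proof -
  have xx: "x * x = S * T" using x by (simp add: power2_eq_square)
  have nz: "S \<noteq> 0" "T \<noteq> 0" "T + 1 \<noteq> 0" using pos by auto
  \<comment> \<open>\<open>S * T < (S + T)^2\<close> bounds \<open>x\<close> in absolute value,
    whichever sign it has.\<close>
  have "\<bar>x\<bar>\<^sup>2 < (S + T)\<^sup>2" using x pos by (simp add: power2_sum) (smt (verit) mult_pos_pos zero_le_power2)
  then have "\<bar>x\<bar> < S + T" by (rule power_less_imp_less_base) (use pos in simp)
  then show a: "S + T + x > 0" by linarith
  have "1 - x + x * x = (x - 1/2) * (x - 1/2) + 3/4" by (simp add: algebra_simps)
  then have b: "1 - x + S * T > 0" unfolding xx using zero_le_square[of "x - 1/2"] by linarith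
  then show "c > 0" unfolding c using pos a by simp
  have "1 + S * T + (S * T)\<^sup>2 = (1 - x + S * T) * (1 + x + S * T)"
    unfolding power2_eq_square by (simp add: algebra_simps xx)
  then show "(1 + S) * (1 + S * T + (S * T)\<^sup>2) * (- x / (S * T)\<^sup>2) / c
      = - x * (1 + S) * (1 + T) * (1 + x + S * T) / (2 * S * T * (S + T + x))"
    unfolding c using nz a b by (simp add: divide_simps power2_eq_square) (simp add: algebra_simps)
qed

text \<open>The traces are exchanged by \<open>r\<close> and \<open>-r\<close>, so their sum and the
  square of their difference involve only \<open>r^2 = S * T\<close>. The common denominator arises
  from \<open>(S + T + r) * (S + T - r) = D\<close>.\<close>

lemma hexagon_trace_sum:
  fixes S T r :: real
  assumes pos: "S > 0" "T > 0" and r: "r\<^sup>2 = S * T"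
    and "S + T + r > 0" "S + T - r > 0"
    and z: "z = - r * (1 + S) * (1 + T) * (1 + r + S * T) / (2 * S * T * (S + T + r))"
    and z': "z' = r * (1 + S) * (1 + T) * (1 - r + S * T) / (2 * S * T * (S + T - r))"
    and D: "D = S\<^sup>2 + S * T + T\<^sup>2"
  shows "z + z' = (S\<^sup>2 - 1) * (T\<^sup>2 - 1) / D"
    and "(z - z')\<^sup>2 = ((1 + S) * (1 + T) * ((1 + S * T) * (S + T) - S * T))\<^sup>2 / (S * T * D\<^sup>2)"
proof -
  define a where "a = S + T + r"
  define b where "b = S + T - r"
  have rr: "r * r = S * T" using r by (simp add: power2_eq_square)
  have nz: "a \<noteq> 0" "b \<noteq> 0" "S \<noteq> 0" "T \<noteq> 0" using assms unfolding a_def b_def by auto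
  have ab: "a * b = D" unfolding a_def b_def D power2_eq_square by (simp add: algebra_simps rr)
  then have nzD: "D \<noteq> 0" using nz by auto
  define K where "K = (1 + S) * (1 + T) / (2 * S * T * D)"
  have "z = K * (- r * (1 + r + S * T) * b)"
    unfolding z a_def[symmetric] K_def ab[symmetric] using nz by (simp add: divide_simps)
  moreover have "z' = K * (r * (1 - r + S * T) * a)"
    unfolding z' b_def[symmetric] K_def ab[symmetric] using nz by (simp add: divide_simps)
  moreover have "- r * (1 + r + S * T) * b + r * (1 - r + S * T) * a = 2 * S * T * (1 + S * T - S - T)"
    unfolding a_def b_def by (simp add: algebra_simps rr)
  moreover have "- r * (1 + r + S * T) * b - r * (1 - r + S * T) * a = - 2 * r * ((1 + S * T) * (S + T) - S * T)"
    unfolding a_def b_def by (simp add: algebra_simps rr)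
  ultimately have sum: "z + z' = K * (2 * S * T * (1 + S * T - S - T))"
    and diff: "z - z' = K * (- 2 * r * ((1 + S * T) * (S + T) - S * T))"
    by (simp_all only: flip: distrib_left right_diff_distrib)
  show "z + z' = (S\<^sup>2 - 1) * (T\<^sup>2 - 1) / D"
    unfolding sum K_def using nz nzD by (simp add: divide_simps power2_eq_square) (simp add: algebra_simps)
  have "(z - z')\<^sup>2 = K\<^sup>2 * (4 * (S * T) * ((1 + S * T) * (S + T) - S * T)\<^sup>2)"
    unfolding diff r[symmetric] by (simp add: power_mult_distrib)
  also have "K\<^sup>2 = ((1 + S) * (1 + T))\<^sup>2 / (4 * (S * T)\<^sup>2 * D\<^sup>2)"
    unfolding K_def by (simp add: power_divide power_mult_distrib)
  also have "((1 + S) * (1 + T))\<^sup>2 / (4 * (S * T)\<^sup>2 * D\<^sup>2) * (4 * (S * T) * ((1 + S * T) * (S + T) - S * T)\<^sup>2)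
      = ((1 + S) * (1 + T) * ((1 + S * T) * (S + T) - S * T))\<^sup>2 / (S * T * D\<^sup>2)"
    using nz nzD by (simp add: field_simps power2_eq_square power_mult_distrib)
  finally show "(z - z')\<^sup>2 = ((1 + S) * (1 + T) * ((1 + S * T) * (S + T) - S * T))\<^sup>2 / (S * T * D\<^sup>2)" .
qed

text \<open>The terms are the values of the octagon eigenfunction at distances 0, 2, 4, 6, 8, each
  times the weight from \<open>octagon_radial_sum\<close> for the eigenvalue
  \<open>s + t\<close>.\<close>

lemma octagon_norm:
  fixes S T :: real
  assumes pos: "S > 0" "T > 0"
  shows "1 + (S - 1) / (S * (T + 1)) * (S - 1) + - 1 / (S * T) * (- S * (T + 1))
      + - (S - 1) / (S * (T + 1)) / (S * T) * (- S * T * (S - 1)) + 1 / (S * T)\<^sup>2 * (S\<^sup>2 * T)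
    = 2 * (S + T) * (S * T + 1) / (S * T * (T + 1))"
  using pos by (simp add: divide_simps power2_eq_square) (simp add: algebra_simps)

lemma octagon_trace_value:
  fixes S T :: real
  assumes pos: "S > 0" "T > 0"
  shows "(1 + S) * (1 + S * T) * (1 + (S * T)\<^sup>2) * (1 / (S * T)\<^sup>2) / (2 * (S + T) * (S * T + 1) / (S * T * (T + 1)))
    = (1 + S) * (1 + T) * (1 + S\<^sup>2 * T\<^sup>2) / (2 * S * T * (S + T))"
proof -
  have "S * T + 1 \<noteq> 0" "S + T \<noteq> 0" "T + 1 \<noteq> 0" using pos by (auto simp: add_pos_pos less_imp_neq[symmetric])
  then show ?thesis using pos by (simp add: divide_simps power2_eq_square) (simp add: algebra_simps)
qed

section \<open>Distances in a generalised polygon\<close>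

locale polygon_geometry =
  fixes n :: nat and \<Gamma> :: "'a pl_geometry"
  assumes polygon: "generalised_polygon n \<Gamma>"
begin

abbreviation P :: "'a set" where "P \<equiv> points \<Gamma>"
abbreviation V :: "'a set" where "V \<equiv> elements \<Gamma>"
abbreviation G :: "'a rel" where "G \<equiv> incidence_graph \<Gamma>"

definition nbrs :: "'a \<Rightarrow> 'a set" where
  "nbrs x = {y. (x, y) \<in> G}"

text \<open>A natural number in place of the extended one of \<open>incidence_dist\<close>;
  \<open>relpow_exists\<close> supplies the walk that makes \<open>LEAST\<close> meaningful, and
  \<open>opposite_dst\<close> links the two.\<close>

definition dst :: "'a \<Rightarrow> 'a \<Rightarrow> nat" where
  "dst x y = (LEAST k. (x, y) \<in> G ^^ k)"

lemma n_ge_2: "2 \<le> n"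
  using polygon unfolding generalised_polygon_def by simp

lemma adj_sym: "(x, y) \<in> G \<Longrightarrow> (y, x) \<in> G"
  unfolding incidence_graph_def by auto

lemma adj_types:
  assumes "(x, y) \<in> G"
  shows "x \<in> V" "y \<in> V" "x \<in> P \<longleftrightarrow> y \<notin> P"
  using assms polygon
  unfolding generalised_polygon_def point_line_geometry_def elements_def incidence_graph_def by auto

lemma mem_nbrs: "y \<in> nbrs x \<longleftrightarrow> (x, y) \<in> G"
  unfolding nbrs_def by simp

lemma inc_iff_adj: "x \<in> P \<Longrightarrow> (x, y) \<in> inc \<Gamma> \<longleftrightarrow> (x, y) \<in> G"
  using polygon unfolding generalised_polygon_def point_line_geometry_def incidence_graph_def by auto

lemma relpow_sym: "(x, y) \<in> G ^^ k \<Longrightarrow> (y, x) \<in> G ^^ k"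
proof (induction k arbitrary: y)
  case (Suc k)
  then obtain z where "(x, z) \<in> G ^^ k" "(z, y) \<in> G" by (meson relpow_Suc_E)
  then show ?case using Suc.IH adj_sym relpow_Suc_I2 by metis
qed simp

lemma relpow_types:
  "(x, y) \<in> G ^^ k \<Longrightarrow> x \<in> V \<Longrightarrow> y \<in> V \<and> ((x \<in> P \<longleftrightarrow> y \<in> P) \<longleftrightarrow> even k)"
proof (induction k arbitrary: y)
  case (Suc k)
  then obtain z where z: "(x, z) \<in> G ^^ k" "(z, y) \<in> G" by (meson relpow_Suc_E)
  then show ?case using Suc.IH[OF z(1) Suc.prems(2)] adj_types[OF z(2)] by auto
qed simp

text \<open>A common ordinary polygon is a closed walk of length \<open>2 * n\<close>, and the
  shorter of the two arcs between \<open>x\<close> and \<open>y\<close> has length at most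
  \<open>n\<close>.\<close>

lemma relpow_exists:
  assumes "x \<in> V" "y \<in> V"
  shows "\<exists>k\<le>n. (x, y) \<in> G ^^ k"
proof -
  have "\<forall>x\<in>V. \<forall>y\<in>V. \<exists>A B. ordinary_polygon n \<Gamma> A B \<and> {x, y} \<subseteq> A \<union> B"
    using polygon unfolding generalised_polygon_def by (elim conjE)
  from this[rule_format, OF assms] obtain A B
    where AB: "ordinary_polygon n \<Gamma> A B" "x \<in> A \<union> B" "y \<in> A \<union> B"
    by (elim exE conjE) simp
  then obtain p l where pl: "bij_betw p {..<n} A" "bij_betw l {..<n} B"
    "\<And>i j. i < n \<Longrightarrow> j < n \<Longrightarrow> (p i, l j) \<in> inc \<Gamma> \<longleftrightarrow> i = j \<or> i = Suc j mod n"
    unfolding ordinary_polygon_def by blast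
  \<comment> \<open>The walk \<open>c\<close> goes round the polygon for ever, with points at even
    and lines at odd times.\<close>
  define c where "c a = (if even a then p (a div 2 mod n) else l (a div 2 mod n))" for a
  have step: "(c a, c (Suc a)) \<in> G" for a
  proof (cases "even a")
    case True
    then have "(p (a div 2 mod n), l (a div 2 mod n)) \<in> inc \<Gamma>" using pl(3) n_ge_2 by simp
    then show ?thesis using True by (simp add: c_def incidence_graph_def)
  next
    case False
    then have "Suc a div 2 = Suc (a div 2)" by presburger
    moreover have "(p (Suc (a div 2) mod n), l (a div 2 mod n)) \<in> inc \<Gamma>"
      using pl(3) n_ge_2 by (simp add: mod_Suc_eq)
    ultimately show ?thesis using False by (simp add: c_def incidence_graph_def)
  qed
  have walk: "(c a, c (a + k)) \<in> G ^^ k" for a k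
  proof (induction k)
    case (Suc k)
    then show ?case using step[of "a + k"] by auto
  qed simp
  have period: "c (a + 2 * n) = c a" for a unfolding c_def by simp
  have cover: "\<exists>a<2 * n. u = c a" if "u \<in> A \<union> B" for u
  proof -
    have "A = p ` {..<n}" "B = l ` {..<n}" using pl(1,2) by (simp_all add: bij_betw_def)
    then consider i where "i < n" "u = p i" | i where "i < n" "u = l i" using \<open>u \<in> A \<union> B\<close> by blast
    then show ?thesis
    proof cases
      case 1 then show ?thesis by (intro exI[of _ "2 * i"]) (simp add: c_def)
    next
      case 2 then show ?thesis by (intro exI[of _ "2 * i + 1"]) (simp add: c_def)
    qed
  qed
  obtain a where a: "a < 2 * n" "x = c a" using cover[OF AB(2)] by blast
  obtain b where b: "b < 2 * n" "y = c b" using cover[OF AB(3)] by blast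
  have main: "\<exists>k\<le>n. (c a, c b) \<in> G ^^ k" if "a \<le> b" "b < 2 * n" for a b
  proof (cases "b - a \<le> n")
    case True
    then show ?thesis using walk[of a "b - a"] that by auto
  next
    case False
    then have "(c b, c a) \<in> G ^^ (a + 2 * n - b)"
      using walk[of b "a + 2 * n - b"] that period[of a] by simp
    then show ?thesis using False that
      by (intro exI[of _ "a + 2 * n - b"]) (auto intro: relpow_sym)
  qed
  show ?thesis
  proof (cases "a \<le> b")
    case True
    then show ?thesis using main[of a b] a b by simp
  next
    case False
    then obtain k where "k \<le> n" "(c b, c a) \<in> G ^^ k" using main[of b a] a by auto
    then show ?thesis using relpow_sym a b by blast
  qed
qed

lemma dst_le: "(x, y) \<in> G ^^ k \<Longrightarrow> dst x y \<le> k"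
  unfolding dst_def by (rule Least_le)

lemma dst_relpow:
  assumes "x \<in> V" "y \<in> V"
  shows "(x, y) \<in> G ^^ dst x y"
proof -
  obtain k where "(x, y) \<in> G ^^ k" using relpow_exists[OF assms] by blast
  then show ?thesis unfolding dst_def by (rule LeastI)
qed

lemma dst_le_n:
  assumes "x \<in> V" "y \<in> V"
  shows "dst x y \<le> n"
proof -
  obtain k where "k \<le> n" "(x, y) \<in> G ^^ k" using relpow_exists[OF assms] by blast
  then show ?thesis using dst_le[of x y k] by simp
qed

lemma dst_sym: "dst x y = dst y x"
proof -
  have "(x, y) \<in> G ^^ k \<longleftrightarrow> (y, x) \<in> G ^^ k" for k using relpow_sym by blast
  then show ?thesis unfolding dst_def by simp
qed

lemma dst_refl: "dst x x = 0"
  using dst_le[of x x 0] by simp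

lemma dst_eq_0: "x \<in> V \<Longrightarrow> y \<in> V \<Longrightarrow> dst x y = 0 \<longleftrightarrow> x = y"
  using dst_relpow[of x y] dst_refl[of x] by auto

lemma dst_parity: "x \<in> V \<Longrightarrow> y \<in> V \<Longrightarrow> even (dst x y) \<longleftrightarrow> (x \<in> P \<longleftrightarrow> y \<in> P)"
  using relpow_types[OF dst_relpow] by blast

lemma dst_triangle:
  assumes "x \<in> V" "y \<in> V" "z \<in> V"
  shows "dst x z \<le> dst x y + dst y z"
proof -
  have "(x, z) \<in> G ^^ dst x y O G ^^ dst y z"
    using dst_relpow[OF assms(1,2)] dst_relpow[OF assms(2,3)] by blast
  then show ?thesis by (simp add: dst_le relpow_add)
qed

lemma dst_adj: "(x, y) \<in> G \<Longrightarrow> dst x y = 1"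
  using dst_le[of x y 1] dst_eq_0[of x y] adj_types[of x y] by (cases "dst x y") auto

text \<open>The triangle inequality allows a change of at most 1, and bipartiteness excludes
  equality.\<close>

lemma dst_adj_cases:
  assumes "(x, x') \<in> G" "y \<in> V"
  shows "dst x' y = Suc (dst x y) \<or> dst x y = Suc (dst x' y)"
proof -
  note v = adj_types[OF assms(1)]
  have "dst x y \<le> 1 + dst x' y" "dst x' y \<le> 1 + dst x y"
    using dst_triangle[OF v(1,2) assms(2)] dst_triangle[OF v(2,1) assms(2)]
      dst_adj[OF assms(1)] dst_adj[OF adj_sym[OF assms(1)]] by auto
  moreover have "dst x y \<noteq> dst x' y"
    using dst_parity[OF v(1) assms(2)] dst_parity[OF v(2) assms(2)] v(3) by auto
  ultimately show ?thesis by linarith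
qed

lemma geodesic_exists:
  assumes "x \<in> V" "y \<in> V"
  shows "\<exists>a. a 0 = x \<and> a (dst x y) = y \<and> (\<forall>j<dst x y. (a j, a (Suc j)) \<in> G)"
  using dst_relpow[OF assms] unfolding relpow_fun_conv by blast

lemma closer_neighbour:
  assumes "x \<in> V" "y \<in> V" "x \<noteq> y"
  shows "\<exists>z. (x, z) \<in> G \<and> dst x y = Suc (dst z y)"
proof -
  obtain i where i: "dst x y = Suc i" using dst_eq_0[OF assms(1,2)] assms(3) by (cases "dst x y") auto
  then have "(x, y) \<in> G ^^ Suc i" using dst_relpow[OF assms(1,2)] by simp
  then obtain z where z: "(x, z) \<in> G" "(z, y) \<in> G ^^ i" by (meson relpow_Suc_E2)
  then show ?thesis using dst_le[OF z(2)] dst_adj_cases[OF z(1) assms(2)] i by auto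
qed

text \<open>Any step towards \<open>y\<close> extends to a geodesic. Its elements have the right
  distance from \<open>x\<close> because a shortcut would shorten the way to
  \<open>y\<close>.\<close>

lemma geodesic_through:
  assumes xz: "(x, z) \<in> G" and y: "y \<in> V" and d: "dst x y = Suc (dst z y)"
  shows "\<exists>a. a 0 = x \<and> a 1 = z \<and> a (dst x y) = y \<and> (\<forall>j<dst x y. (a j, a (Suc j)) \<in> G) \<and>
    (\<forall>j\<le>dst x y. a j \<in> V \<and> dst (a j) x = j)"
proof -
  note v = adj_types[OF xz]
  obtain b where b: "b 0 = z" "b (dst z y) = y" "\<And>j. j < dst z y \<Longrightarrow> (b j, b (Suc j)) \<in> G"
    using geodesic_exists[OF v(2) y] by blast
  define a where "a j = (case j of 0 \<Rightarrow> x | Suc k \<Rightarrow> b k)" for j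
  have adj: "(a j, a (Suc j)) \<in> G" if "j < dst x y" for j
    using that b xz d by (cases j) (auto simp: a_def)
  have aV: "a j \<in> V" if j: "j \<le> dst x y" for j
  proof (cases "j = dst x y")
    case True
    then show ?thesis using b(2) y d by (simp add: a_def)
  next
    case False
    then show ?thesis using adj_types(1)[OF adj] j by simp
  qed
  have pow: "(a i, a (i + k)) \<in> G ^^ k" if "i + k \<le> dst x y" for i k
    using that
  proof (induction k)
    case (Suc k)
    then show ?case using adj[of "i + k"] by auto
  qed simp
  have "dst (a j) x = j" if j: "j \<le> dst x y" for j
  proof -
    have "dst x (a j) \<le> j" using dst_le[OF pow[of 0 j]] j by (simp add: a_def)
    moreover have "dst (a j) y \<le> dst x y - j"
      using dst_le[OF pow[of j "dst x y - j"]] j b(2) d by (simp add: a_def)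
    moreover have "dst x y \<le> dst x (a j) + dst (a j) y"
      using dst_triangle[OF v(1) aV[OF j] y] .
    ultimately show ?thesis using j dst_sym[of x "a j"] by linarith
  qed
  then show ?thesis using adj aV b d by (intro exI[of _ a]) (auto simp: a_def)
qed

section \<open>Short induced cycles and uniqueness of geodesics\<close>

lemma ordinary_polygon_of_cycle_point:
  assumes k: "2 \<le> k" and inj: "inj_on c {..<2 * k}" and c0: "c 0 \<in> P"
    and adj: "\<And>i j. i < 2 * k \<Longrightarrow> j < 2 * k \<Longrightarrow>
      (c i, c j) \<in> G \<longleftrightarrow> j = Suc i mod (2 * k) \<or> i = Suc j mod (2 * k)"
  shows "\<exists>A B. ordinary_polygon k \<Gamma> A B"
proof -
  have type: "i < 2 * k \<Longrightarrow> c i \<in> P \<longleftrightarrow> even i" for i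
  proof (induction i)
    case (Suc i)
    then have "(c i, c (Suc i)) \<in> G" using adj[of i "Suc i"] by simp
    then show ?case using Suc adj_types(3) by auto
  qed (use c0 in simp)
  have cV: "c i \<in> V" if "i < 2 * k" for i
    using adj[of i "Suc i mod (2 * k)"] that k adj_types(1) by fastforce
  define p where "p i = c (2 * i)" for i
  define l where "l i = c (2 * i + 1)" for i
  have "bij_betw p {..<k} (p ` {..<k})"
    by (intro inj_on_imp_bij_betw inj_onI) (auto simp: p_def dest!: inj_onD[OF inj])
  moreover have "bij_betw l {..<k} (l ` {..<k})"
    by (intro inj_on_imp_bij_betw inj_onI) (auto simp: l_def dest!: inj_onD[OF inj])
  moreover have "p ` {..<k} \<subseteq> P" using type by (auto simp: p_def)
  moreover have "l ` {..<k} \<subseteq> lines \<Gamma>"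
  proof
    fix u assume "u \<in> l ` {..<k}"
    then obtain i where i: "i < k" "u = c (2 * i + 1)" by (auto simp: l_def)
    then have "u \<in> V" "u \<notin> P" using cV[of "2 * i + 1"] type[of "2 * i + 1"] by auto
    then show "u \<in> lines \<Gamma>" by (simp add: elements_def)
  qed
  moreover have "(p i, l j) \<in> inc \<Gamma> \<longleftrightarrow> i = j \<or> i = Suc j mod k" if ij: "i < k" "j < k" for i j
  proof -
    have "(p i, l j) \<in> inc \<Gamma> \<longleftrightarrow> (c (2 * i), c (2 * j + 1)) \<in> G"
      using inc_iff_adj type[of "2 * i"] ij by (simp add: p_def l_def)
    also have "\<dots> \<longleftrightarrow> 2 * j + 1 = Suc (2 * i) mod (2 * k) \<or> 2 * i = Suc (2 * j + 1) mod (2 * k)"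
      using ij by (intro adj) auto
    also have "Suc (2 * i) mod (2 * k) = Suc (2 * i)" using ij by simp
    also have "Suc (2 * j + 1) mod (2 * k) = 2 * (Suc j mod k)"
      by (simp add: mult_mod_right)
    finally show ?thesis by auto
  qed
  ultimately have "ordinary_polygon k \<Gamma> (p ` {..<k}) (l ` {..<k})"
    unfolding ordinary_polygon_def by (intro conjI exI[of _ p] exI[of _ l] allI impI)
  then show ?thesis by blast
qed

lemma ordinary_polygon_of_cycle:
  assumes k: "2 \<le> k" and inj: "inj_on c {..<2 * k}"
    and adj: "\<And>i j. i < 2 * k \<Longrightarrow> j < 2 * k \<Longrightarrow>
      (c i, c j) \<in> G \<longleftrightarrow> j = Suc i mod (2 * k) \<or> i = Suc j mod (2 * k)"
  shows "\<exists>A B. ordinary_polygon k \<Gamma> A B"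
proof (cases "c 0 \<in> P")
  case True
  then show ?thesis using ordinary_polygon_of_cycle_point[OF k inj _ adj] by blast
next
  case False
  have "(c 0, c 1) \<in> G" using adj[of 0 1] k by simp
  then have c1: "c 1 \<in> P" using False adj_types(3) by blast
  \<comment> \<open>Rotating the cycle by one place makes it start at a point.\<close>
  define c' where "c' i = c (Suc i mod (2 * k))" for i
  have inj_shift: "Suc i mod (2 * k) = Suc j mod (2 * k) \<longleftrightarrow> i = j" if "i < 2 * k" "j < 2 * k" for i j
    using that by (auto simp: mod_Suc split: if_splits)
  show ?thesis
  proof (rule ordinary_polygon_of_cycle_point[OF k])
    show "inj_on c' {..<2 * k}"
    proof (rule inj_onI)
      fix i j assume ij: "i \<in> {..<2 * k}" "j \<in> {..<2 * k}" "c' i = c' j"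
      then have "Suc i mod (2 * k) = Suc j mod (2 * k)"
        unfolding c'_def using k by (intro inj_onD[OF inj]) auto
      then show "i = j" using inj_shift ij by auto
    qed
    show "c' 0 \<in> P" using c1 k by (simp add: c'_def)
    fix i j assume ij: "i < 2 * k" "j < 2 * k"
    have "(c' i, c' j) \<in> G \<longleftrightarrow> Suc j mod (2 * k) = Suc (Suc i mod (2 * k)) mod (2 * k) \<or>
        Suc i mod (2 * k) = Suc (Suc j mod (2 * k)) mod (2 * k)"
      unfolding c'_def using ij k by (intro adj) auto
    also have "\<dots> \<longleftrightarrow> j = Suc i mod (2 * k) \<or> i = Suc j mod (2 * k)"
      using inj_shift[of j "Suc i mod (2 * k)"] inj_shift[of i "Suc j mod (2 * k)"] ij by auto
    finally show "(c' i, c' j) \<in> G \<longleftrightarrow> j = Suc i mod (2 * k) \<or> i = Suc j mod (2 * k)" .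
  qed
qed

text \<open>Two different geodesics of minimal length with common ends form an induced cycle, hence an
  ordinary polygon that is too small.\<close>
lemma closer_neighbour_unique:
  assumes "x \<in> V" "y \<in> V" "dst x y < n"
    and "(x, z) \<in> G" "dst x y = Suc (dst z y)" "(x, z') \<in> G" "dst x y = Suc (dst z' y)"
  shows "z = z'"
  using assms
proof (induction "dst x y" arbitrary: x y z z' rule: less_induct)
  case less
  define i where "i = dst x y"
  \<comment> \<open>The induction hypothesis is read with \<open>x\<close> as the target: an element
    at distance below \<open>i\<close> from \<open>x\<close> has at most one neighbour closer to
    \<open>x\<close>.\<close>
  have IH: "u = u'" if "dst w x < i" "(w, u) \<in> G" "dst w x = Suc (dst u x)"
    "(w, u') \<in> G" "dst w x = Suc (dst u' x)" for w u u'
    using less.hyps[of w x u u'] that less.prems(1,3) adj_types(1)[OF that(2)] unfolding i_def by auto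
  show ?case
  proof (rule ccontr)
    assume neq: "z \<noteq> z'"
    obtain a where a: "a 0 = x" "a 1 = z" "a i = y" "\<And>j. j < i \<Longrightarrow> (a j, a (Suc j)) \<in> G"
      "\<And>j. j \<le> i \<Longrightarrow> a j \<in> V" "\<And>j. j \<le> i \<Longrightarrow> dst (a j) x = j"
      using geodesic_through[OF less.prems(4,2,5)] unfolding i_def by blast
    obtain b where b: "b 0 = x" "b 1 = z'" "b i = y" "\<And>j. j < i \<Longrightarrow> (b j, b (Suc j)) \<in> G"
      "\<And>j. j \<le> i \<Longrightarrow> b j \<in> V" "\<And>j. j \<le> i \<Longrightarrow> dst (b j) x = j"
      using geodesic_through[OF less.prems(6,2,7)] unfolding i_def by blast
    have i: "2 \<le> i" "i < n" using neq a(2,3) b(2,3) less.prems(3,5) unfolding i_def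
      by (cases "dst z y"; auto)+
    \<comment> \<open>If the geodesics met at an inner level, \<open>IH\<close> would make them
      agree on all lower levels, down to \<open>z = z'\<close>.\<close>
    have ab: "0 < j \<Longrightarrow> j < i \<Longrightarrow> a j \<noteq> b j" for j
    proof (induction j)
      case (Suc j)
      show ?case
      proof (cases "j = 0")
        case True
        then show ?thesis using neq a(2) b(2) by simp
      next
        case False
        show ?thesis
        proof
          assume eq: "a (Suc j) = b (Suc j)"
          have "a j = b j"
            using IH[of "a (Suc j)" "a j" "b j"] a(6) b(6) Suc.prems eq
              adj_sym[OF a(4), of j] adj_sym[OF b(4), of j] by simp
          then show False using Suc False by simp
        qed
      qed
    qed simp
    \<comment> \<open>The closed walk climbs from \<open>x\<close> to \<open>y\<close> along
      \<open>a\<close> and returns along \<open>b\<close>; \<open>lev\<close> is the distance from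
      \<open>x\<close>.\<close>
    define c where "c m = (if m \<le> i then a m else b (2 * i - m))" for m
    define lev where "lev m = (if m \<le> i then m else 2 * i - m)" for m
    have lev: "dst (c m) x = lev m" if "m < 2 * i" for m
      using that a(6)[of m] b(6)[of "2 * i - m"] by (auto simp: c_def lev_def)
    have cV: "c m \<in> V" if "m < 2 * i" for m
      using that a(5)[of m] b(5)[of "2 * i - m"] by (auto simp: c_def)
    have ne: "c m \<noteq> c m'" if m: "m \<le> i" "i < m'" "m' < 2 * i" for m m'
    proof
      assume eq: "c m = c m'"
      then have "lev m = lev m'" using lev[of m] lev[of m'] m by simp
      then have "2 * i - m' = m" "0 < m" "m < i" using m by (auto simp: lev_def)
      moreover have "a m = b (2 * i - m')" using eq m by (simp add: c_def)
      ultimately show False using ab by simp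
    qed
    have inj: "m = m'" if m: "m < 2 * i" "m' < 2 * i" and eq: "c m = c m'" for m m'
    proof -
      have "lev m = lev m'" using lev[OF m(1)] lev[OF m(2)] eq by simp
      moreover have "m \<le> i \<longleftrightarrow> m' \<le> i"
        using ne[of m m'] ne[of m' m] m eq by (metis not_le)
      ultimately show ?thesis using m by (auto simp: lev_def split: if_splits)
    qed
    have step: "(c m, c (Suc m mod (2 * i))) \<in> G" if m: "m < 2 * i" for m
    proof -
      consider "m < i" | "m = i" | "i < m" "Suc m < 2 * i" | "Suc m = 2 * i" "i < m"
        using m i by linarith
      then show ?thesis
      proof cases
        case 1 then show ?thesis using a(4)[of m] by (simp add: c_def)
      next
        case 2
        then show ?thesis using adj_sym[OF b(4)[of "i - 1"]] i a(3) b(3) by (simp add: c_def mult_2)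
      next
        case 3
        then have "Suc (2 * i - Suc m) = 2 * i - m" by simp
        then show ?thesis using 3 adj_sym[OF b(4)[of "2 * i - Suc m"]] by (simp add: c_def)
      next
        case 4
        then have "2 * i - m = Suc 0" by simp
        then show ?thesis using 4 adj_sym[OF b(4)[of 0]] a(1) b(1) i by (simp add: c_def)
      qed
    qed
    \<comment> \<open>There are no chords: an edge joins consecutive levels, and below the top
      \<open>y\<close> its upper end has only one neighbour closer to \<open>x\<close>, which is
      already its neighbour on the cycle. At level \<open>i - 1\<close> both elements of the cycle
      are neighbours of \<open>y\<close> on it.\<close>
    have level_up: "m' = Suc m mod (2 * i) \<or> m = Suc m' mod (2 * i)"
      if m: "m < 2 * i" "m' < 2 * i" and adj: "(c m, c m') \<in> G" and lev_up: "lev m' = Suc (lev m)" for m m'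
    proof (cases "m' = i")
      case True
      then have "m = i - 1 \<or> m = i + 1" using m lev_up i by (auto simp: lev_def split: if_splits)
      then show ?thesis using True i by auto
    next
      case False
      then have "lev m' < i" using m by (auto simp: lev_def)
      have *: "c m = u" if "(c m', u) \<in> G" "lev m' = Suc (dst u x)" for u
        using IH[of "c m'" "c m" u] \<open>lev m' < i\<close> lev[OF m(1)] lev[OF m(2)] lev_up that adj_sym[OF adj] by simp
      show ?thesis
      proof (cases "m' < i")
        case True
        then have "m' \<noteq> 0" using lev_up by (auto simp: lev_def)
        then obtain j where j: "m' = Suc j" by (cases m') auto
        have "c m = c j"
          using *[of "c j"] step[of j] adj_sym True j lev[of j] by (auto simp: lev_def)
        then have "m = j" using inj[of m j] m j by simp
        then show ?thesis using j m by simp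
      next
        case m'i: False
        have "(c m', c (Suc m' mod (2 * i))) \<in> G" using step m by blast
        moreover have "dst (c (Suc m' mod (2 * i))) x = lev (Suc m' mod (2 * i))"
          using i by (intro lev) simp
        moreover have "lev m' = Suc (lev (Suc m' mod (2 * i)))"
          using m'i False m i by (auto simp: lev_def mod_Suc)
        ultimately have "c m = c (Suc m' mod (2 * i))" using * by simp
        then have "m = Suc m' mod (2 * i)" using i m by (intro inj) auto
        then show ?thesis by simp
      qed
    qed
    have adj: "(c m, c m') \<in> G \<longleftrightarrow> m' = Suc m mod (2 * i) \<or> m = Suc m' mod (2 * i)"
      if m: "m < 2 * i" "m' < 2 * i" for m m'
    proof
      assume e: "(c m, c m') \<in> G"
      then have "lev m' = Suc (lev m) \<or> lev m = Suc (lev m')"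
        using dst_adj_cases[OF e less.prems(1)] lev m by simp
      then show "m' = Suc m mod (2 * i) \<or> m = Suc m' mod (2 * i)"
        using level_up[OF m e] level_up[OF m(2,1) adj_sym[OF e]] by blast
    next
      assume "m' = Suc m mod (2 * i) \<or> m = Suc m' mod (2 * i)"
      then show "(c m, c m') \<in> G" using step m adj_sym by blast
    qed
    \<comment> \<open>A cycle of \<open>2 * i\<close> elements is an ordinary polygon with
      \<open>i\<close> points, and \<open>2 \<le> i < n\<close>.\<close>
    have "\<exists>A B. ordinary_polygon i \<Gamma> A B"
      using inj by (intro ordinary_polygon_of_cycle[OF i(1) _ adj] inj_onI) auto
    then show False using polygon i unfolding generalised_polygon_def by blast
  qed
qed

end

section \<open>Finite thick polygons\<close>

locale finite_thick_polygon = polygon_geometry +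
  assumes finite_geometry: "finite_geometry \<Gamma>" and thick: "thick \<Gamma>" and even_n: "even n"
begin

lemma finite_V: "finite V" and finite_P: "finite P"
  using finite_geometry unfolding finite_geometry_def elements_def by auto

lemma P_subset_V: "P \<subseteq> V"
  unfolding elements_def by blast

lemma P_in_V: "x \<in> P \<Longrightarrow> x \<in> V"
  unfolding elements_def by blast

lemma nbrs_subset_V: "nbrs x \<subseteq> V"
  using adj_types(2) by (auto simp: mem_nbrs)

lemma finite_nbrs: "finite (nbrs x)"
  using finite_V nbrs_subset_V by (rule rev_finite_subset)

lemma card_nbrs_ge_3:
  assumes "x \<in> V"
  shows "3 \<le> card (nbrs x)"
proof -
  have "\<exists>S\<subseteq>nbrs x. card S = 3"
  proof (cases "x \<in> P")
    case True
    then obtain S where "S \<subseteq> {l \<in> lines \<Gamma>. (x, l) \<in> inc \<Gamma>}" "card S = 3"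
      using thick unfolding thick_def by blast
    then show ?thesis by (intro exI[of _ S]) (auto simp: nbrs_def incidence_graph_def)
  next
    case False
    then have "x \<in> lines \<Gamma>" using assms unfolding elements_def by blast
    then obtain S where "S \<subseteq> {p \<in> points \<Gamma>. (p, x) \<in> inc \<Gamma>}" "card S = 3"
      using thick unfolding thick_def by blast
    then show ?thesis by (intro exI[of _ S]) (auto simp: nbrs_def incidence_graph_def)
  qed
  then show ?thesis using card_mono[OF finite_nbrs] by metis
qed

section \<open>Neighbours, their distances and their number\<close>

lemma neighbours_split:
  assumes "x \<in> V" "y \<in> V" "x \<noteq> y" "dst x y < n"
  shows "\<exists>z0\<in>nbrs x. Suc (dst z0 y) = dst x y \<and> (\<forall>z\<in>nbrs x - {z0}. dst z y = Suc (dst x y))"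
proof -
  obtain z0 where z0: "(x, z0) \<in> G" "dst x y = Suc (dst z0 y)"
    using closer_neighbour[OF assms(1-3)] by blast
  have "dst z y = Suc (dst x y)" if "z \<in> nbrs x - {z0}" for z
    using dst_adj_cases[of x z y] closer_neighbour_unique[OF assms(1,2,4) z0, of z] that assms(2)
    by (auto simp: mem_nbrs)
  then show ?thesis using z0 by (intro bexI[of _ z0]) (auto simp: mem_nbrs)
qed

lemma neighbours_opposite:
  assumes "x \<in> V" "y \<in> V" "dst x y = n" "z \<in> nbrs x"
  shows "Suc (dst z y) = n"
  using dst_adj_cases[of x z y] dst_le_n[of z y] assms adj_types(2)[of x z] by (auto simp: mem_nbrs)

lemma sum_nbrs_same:
  assumes "x \<in> V"
  shows "(\<Sum>z\<in>nbrs x. f (dst z x) :: real) = real (card (nbrs x)) * f 1"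
  using dst_adj adj_sym by (simp add: mem_nbrs)

lemma sum_nbrs_opposite:
  assumes "x \<in> V" "y \<in> V" "dst x y = n"
  shows "(\<Sum>z\<in>nbrs x. f (dst z y) :: real) = real (card (nbrs x)) * f (n - 1)"
proof -
  have "dst z y = n - 1" if "z \<in> nbrs x" for z using neighbours_opposite[OF assms that] by simp
  then show ?thesis by simp
qed

lemma sum_nbrs_between:
  assumes "x \<in> V" "y \<in> V" "x \<noteq> y" "dst x y < n"
  shows "(\<Sum>z\<in>nbrs x. f (dst z y) :: real) =
    f (dst x y - 1) + (real (card (nbrs x)) - 1) * f (dst x y + 1)"
proof -
  obtain z0 where z0: "z0 \<in> nbrs x" "Suc (dst z0 y) = dst x y"
    "\<And>z. z \<in> nbrs x - {z0} \<Longrightarrow> dst z y = Suc (dst x y)"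
    using neighbours_split[OF assms] by blast
  have "(\<Sum>z\<in>nbrs x. f (dst z y)) = f (dst z0 y) + (\<Sum>z\<in>nbrs x - {z0}. f (dst z y))"
    using z0(1) finite_nbrs by (rule sum.remove[rotated])
  also have "(\<Sum>z\<in>nbrs x - {z0}. f (dst z y)) = (\<Sum>z\<in>nbrs x - {z0}. f (dst x y + 1))"
    using z0(3) by (intro sum.cong) auto
  also have "\<dots> = (real (card (nbrs x)) - 1) * f (dst x y + 1)"
    using z0(1) finite_nbrs card_nbrs_ge_3[OF assms(1)] by (simp add: card_Diff_singleton of_nat_diff)
  also have "dst z0 y = dst x y - 1" using z0(2) by simp
  finally show ?thesis .
qed

text \<open>Sending a neighbour \<open>z\<close> of \<open>x\<close> to a neighbour of
  \<open>y\<close> at distance \<open>n - 2\<close> from \<open>z\<close> is injective: the image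
  has distance \<open>n - 1\<close> from \<open>x\<close>, so only one neighbour of \<open>x\<close>
  is closer to it.\<close>

lemma card_nbrs_opposite_le:
  assumes "x \<in> V" "y \<in> V" "dst x y = n"
  shows "card (nbrs x) \<le> card (nbrs y)"
proof -
  have "\<exists>w. w \<in> nbrs y \<and> Suc (Suc (dst w z)) = n" if z: "z \<in> nbrs x" for z
  proof -
    have zy: "Suc (dst z y) = n" by (rule neighbours_opposite[OF assms z])
    then have "y \<noteq> z" using dst_refl n_ge_2 by force
    moreover have "z \<in> V" using z nbrs_subset_V by blast
    ultimately obtain w where "(y, w) \<in> G" "dst y z = Suc (dst w z)"
      using closer_neighbour[of y z] assms(2) by blast
    then show ?thesis using zy dst_sym[of y z] by (auto simp: mem_nbrs)
  qed
  then obtain f where f: "\<And>z. z \<in> nbrs x \<Longrightarrow> f z \<in> nbrs y \<and> Suc (Suc (dst (f z) z)) = n" by metis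
  have "inj_on f (nbrs x)"
  proof (rule inj_onI)
    fix z z' assume z: "z \<in> nbrs x" "z' \<in> nbrs x" "f z = f z'"
    have yx: "dst y x = n" using assms(3) dst_sym by simp
    have "f z \<in> nbrs y" using f z by blast
    then have "f z \<in> V" "Suc (dst (f z) x) = n"
      using nbrs_subset_V neighbours_opposite[OF assms(2,1) yx] by auto
    moreover have "Suc (Suc (dst z (f z))) = n" "Suc (Suc (dst z' (f z))) = n"
      using f[OF z(1)] f[OF z(2)] z(3) dst_sym by simp_all
    ultimately show "z = z'"
      using closer_neighbour_unique[of x "f z" z z'] assms(1) z(1,2) dst_sym[of x "f z"]
      by (simp add: mem_nbrs)
  qed
  then show ?thesis using f finite_nbrs by (intro card_inj_on_le[of f]) auto
qed

lemma card_nbrs_opposite: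
  "x \<in> V \<Longrightarrow> y \<in> V \<Longrightarrow> dst x y = n \<Longrightarrow> card (nbrs x) = card (nbrs y)"
  using card_nbrs_opposite_le[of x y] card_nbrs_opposite_le[of y x] dst_sym[of x y] by simp

text \<open>Continuing from a third element \<open>z\<close> incident with \<open>l\<close> one reaches an element opposite both
  \<open>x\<close> and \<open>y\<close>.\<close>
lemma card_nbrs_common_neighbour:
  assumes "(x, l) \<in> G" "(y, l) \<in> G"
  shows "card (nbrs x) = card (nbrs y)"
proof -
  note v = adj_types(1,2)[OF assms(1)] adj_types(1)[OF assms(2)]
  have "\<not> nbrs l \<subseteq> {x, y}"
    using card_nbrs_ge_3[OF v(2)] card_mono[of "{x, y}" "nbrs l"] card_insert_le_m1[of 2 "{y}" x] by force
  then obtain z where "z \<in> nbrs l" "z \<notin> {x, y}" by blast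
  then have z: "(l, z) \<in> G" "z \<noteq> x" "z \<noteq> y" by (auto simp: mem_nbrs)
  have zV: "z \<in> V" using z(1) adj_types(2) by blast
  \<comment> \<open>Starting at \<open>z\<close>, each step avoids the one neighbour that is closer
    to \<open>l\<close>; thickness provides another.\<close>
  have ext: "\<exists>w\<in>V. dst w l = Suc i \<and> dst w z = i" if "Suc i < n" for i
    using that
  proof (induction i)
    case 0
    then show ?case using dst_adj[OF adj_sym[OF z(1)]] dst_refl zV by (intro bexI[of _ z]) auto
  next
    case (Suc i)
    then obtain w where w: "w \<in> V" "dst w l = Suc i" "dst w z = i" by auto
    then have "w \<noteq> l" using dst_refl by auto
    then obtain z0 where z0: "\<And>w'. w' \<in> nbrs w - {z0} \<Longrightarrow> dst w' l = Suc (dst w l)"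
      using neighbours_split[OF w(1) v(2)] w(2) Suc.prems by auto
    have "\<not> nbrs w \<subseteq> {z0}"
      using card_nbrs_ge_3[OF w(1)] card_mono[of "{z0}" "nbrs w"] by auto
    then obtain w' where w': "w' \<in> nbrs w" "dst w' l = Suc (Suc i)" using z0 w(2) by auto
    have w'V: "w' \<in> V" using w'(1) nbrs_subset_V by blast
    have "dst w' l \<le> dst w' z + 1"
      using dst_triangle[OF w'V zV v(2)] dst_adj[OF adj_sym[OF z(1)]] by simp
    then have "dst w' z = Suc i"
      using dst_adj_cases[of w w' z] w'(1) zV w(3) w'(2) by (auto simp: mem_nbrs)
    then show ?case using w' w'V by auto
  qed
  obtain w where w: "w \<in> V" "Suc (dst w l) = n" "Suc (Suc (dst w z)) = n"
    using ext[of "n - 2"] n_ge_2 by (auto simp: numeral_2_eq_2 Suc_diff_Suc)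
  \<comment> \<open>From \<open>l\<close>, at distance \<open>n - 1\<close>, only \<open>z\<close>
    leads closer to \<open>w\<close>, so every other neighbour of \<open>l\<close> is opposite
    \<open>w\<close>.\<close>
  have opp: "dst w u = n" if "(u, l) \<in> G" "u \<noteq> z" for u
  proof -
    have "dst l w = Suc (dst z w)" using w dst_sym[of l w] dst_sym[of z w] by simp
    moreover have "dst l w < n" using w(2) dst_sym[of l w] by simp
    ultimately have "dst l w \<noteq> Suc (dst u w)"
      using closer_neighbour_unique[OF v(2) w(1) _ z(1)] adj_sym[OF that(1)] that(2) by blast
    then show ?thesis
      using dst_adj_cases[OF adj_sym[OF that(1)] w(1)] w(2) dst_sym[of l w] dst_sym[of u w] by auto
  qed
  have "card (nbrs w) = card (nbrs x)" using card_nbrs_opposite[OF w(1) v(1)] opp[OF assms(1)] z(2) by simp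
  moreover have "card (nbrs w) = card (nbrs y)" using card_nbrs_opposite[OF w(1) v(3)] opp[OF assms(2)] z(3) by simp
  ultimately show ?thesis by simp
qed

lemma card_nbrs_even_walk: "(x, y) \<in> G ^^ (2 * k) \<Longrightarrow> card (nbrs x) = card (nbrs y)"
proof (induction k arbitrary: y)
  case (Suc k)
  then have "(x, y) \<in> G ^^ Suc (Suc (2 * k))" by simp
  then obtain w w' where "(x, w) \<in> G ^^ (2 * k)" "(w, w') \<in> G" "(w', y) \<in> G"
    by (meson relpow_Suc_E)
  then show ?case using Suc.IH card_nbrs_common_neighbour[of w w' y] adj_sym by auto
qed simp

lemma card_nbrs_same_type:
  assumes "x \<in> V" "y \<in> V" "x \<in> P \<longleftrightarrow> y \<in> P"
  shows "card (nbrs x) = card (nbrs y)"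
proof -
  have "even (dst x y)" using dst_parity assms by blast
  then obtain k where "dst x y = 2 * k" by blast
  then show ?thesis using card_nbrs_even_walk[of x y k] dst_relpow[OF assms(1,2)] by simp
qed

lemma exists_point: "\<exists>p. p \<in> P"
proof -
  obtain x where x: "x \<in> V" using polygon unfolding generalised_polygon_def by blast
  then have "nbrs x \<noteq> {}" using card_nbrs_ge_3[OF x] by auto
  then obtain y where "(x, y) \<in> G" by (auto simp: mem_nbrs)
  then show ?thesis using adj_types(3) by blast
qed

text \<open>The usual order: \<open>t + 1\<close> lines on each point and \<open>s + 1\<close>
  points on each line. By \<open>card_nbrs_same_type\<close> the choice is immaterial.\<close>

definition t :: nat where "t = card (nbrs (SOME p. p \<in> P)) - 1"
definition s :: nat where "s = card (nbrs (SOME l. l \<in> V - P)) - 1"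

lemma card_nbrs_point:
  assumes "p \<in> P"
  shows "card (nbrs p) = t + 1" "2 \<le> t"
proof -
  define q where "q = (SOME p. p \<in> P)"
  have "q \<in> P" unfolding q_def using assms by (rule someI)
  then have "card (nbrs p) = card (nbrs q)" using assms P_in_V by (intro card_nbrs_same_type) auto
  then show "card (nbrs p) = t + 1" "2 \<le> t"
    using card_nbrs_ge_3[of p] P_in_V[OF assms] unfolding t_def q_def[symmetric] by auto
qed

lemma card_nbrs_line:
  assumes "l \<in> V - P"
  shows "card (nbrs l) = s + 1" "2 \<le> s"
proof -
  define q where "q = (SOME l. l \<in> V - P)"
  have "q \<in> V - P" unfolding q_def using assms by (rule someI)
  then have "card (nbrs l) = card (nbrs q)" using assms by (intro card_nbrs_same_type) auto
  then show "card (nbrs l) = s + 1" "2 \<le> s"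
    using card_nbrs_ge_3[of l] assms unfolding s_def q_def[symmetric] by auto
qed

lemma nbrs_point: "p \<in> P \<Longrightarrow> l \<in> nbrs p \<Longrightarrow> l \<in> V - P"
  using adj_types[of p l] by (simp add: mem_nbrs)

lemma order_ge_2: "2 \<le> s" "2 \<le> t"
proof -
  obtain p where p: "p \<in> P" using exists_point by blast
  show "2 \<le> t" using card_nbrs_point[OF p] by blast
  have "nbrs p \<noteq> {}" using card_nbrs_ge_3[of p] P_in_V[OF p] by auto
  then obtain l where "l \<in> nbrs p" by blast
  then show "2 \<le> s" using card_nbrs_line[OF nbrs_point[OF p]] by blast
qed

text \<open>This is \<open>t + 1\<close> plus the adjacency operator of the collinearity graph, because \<open>z = x\<close> occurs
  once for each line on \<open>x\<close>.\<close>
definition collinearity :: "('a \<Rightarrow> real) \<Rightarrow> 'a \<Rightarrow> real" where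
  "collinearity g x = (\<Sum>l\<in>nbrs x. \<Sum>z\<in>nbrs l. g z)"

text \<open>For even \<open>j\<close>, row \<open>j\<close> of the intersection matrix of the
  collinearity graph plus \<open>t + 1\<close>. Strictly between 0 and \<open>n\<close> one line on
  the point is at distance \<open>j - 1\<close> and \<open>t\<close> lines are at distance
  \<open>j + 1\<close>; each line has one nearest point and \<open>s\<close> others.\<close>

definition radial_collinearity :: "(nat \<Rightarrow> real) \<Rightarrow> nat \<Rightarrow> real" where
  "radial_collinearity F j =
    (if j = 0 then (real t + 1) * (F 0 + real s * F 2)
     else if j < n then F (j - 2) + real s * F j + real t * (F j + real s * F (j + 2))
     else (real t + 1) * (F (n - 2) + real s * F n))"

text \<open>Summing by lines first turns either side into the sum over all lines of the product of
  the two line sums.\<close>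

lemma collinearity_self_adjoint:
  "(\<Sum>x\<in>P. f x * collinearity g x) = (\<Sum>x\<in>P. collinearity f x * g x)"
proof -
  define W where "W = V - P"
  have fW: "finite W" unfolding W_def using finite_V by simp
  have 1: "nbrs x = {l \<in> W. (x, l) \<in> G}" if "x \<in> P" for x
    using that adj_types[of x] unfolding W_def nbrs_def by blast
  have 2: "nbrs l = {x \<in> P. (x, l) \<in> G}" if "l \<in> W" for l
    using that adj_types[of _ l] adj_sym[of l] adj_sym[of _ l] unfolding W_def nbrs_def by blast
  have *: "(\<Sum>x\<in>P. f x * collinearity g x) = (\<Sum>l\<in>W. (\<Sum>x\<in>nbrs l. f x) * (\<Sum>z\<in>nbrs l. g z))" for f g
  proof -
    have "(\<Sum>x\<in>P. f x * collinearity g x) = (\<Sum>x\<in>P. \<Sum>l\<in>{l \<in> W. (x, l) \<in> G}. f x * (\<Sum>z\<in>nbrs l. g z))"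
      unfolding collinearity_def by (intro sum.cong) (simp_all add: 1 sum_distrib_left)
    also have "\<dots> = (\<Sum>l\<in>W. \<Sum>x\<in>{x \<in> P. (x, l) \<in> G}. f x * (\<Sum>z\<in>nbrs l. g z))"
      by (rule sum.swap_restrict[OF finite_P fW])
    also have "\<dots> = (\<Sum>l\<in>W. (\<Sum>x\<in>nbrs l. f x) * (\<Sum>z\<in>nbrs l. g z))"
      by (intro sum.cong) (simp_all add: 2 sum_distrib_right)
    finally show ?thesis .
  qed
  show ?thesis using *[of f g] *[of g f] by (simp add: mult.commute)
qed

text \<open>As \<open>n\<close> is even, a line is at odd distance from \<open>y\<close>, hence
  neither equal nor opposite to it. So its inner sum is a function \<open>h\<close> of that distance
  alone.\<close>

lemma collinearity_radial:
  assumes x: "x \<in> P" and y: "y \<in> P"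
  shows "collinearity (\<lambda>z. F (dst z y)) x = radial_collinearity F (dst x y)"
proof -
  define h where "h j = F (j - 1) + real s * F (j + 1)" for j
  have "(\<Sum>z\<in>nbrs l. F (dst z y)) = h (dst l y)" if l: "l \<in> nbrs x" for l
  proof -
    have lW: "l \<in> V - P" by (rule nbrs_point[OF x l])
    then have "odd (dst l y)" using dst_parity[of l y] y P_in_V by auto
    then have "dst l y \<noteq> n" "l \<noteq> y" using even_n dst_refl by auto
    moreover have "dst l y \<le> n" using dst_le_n lW P_in_V[OF y] by blast
    ultimately show ?thesis
      using sum_nbrs_between[of l y F] lW P_in_V[OF y] card_nbrs_line[OF lW] by (simp add: h_def)
  qed
  then have *: "collinearity (\<lambda>z. F (dst z y)) x = (\<Sum>l\<in>nbrs x. h (dst l y))"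
    unfolding collinearity_def by (intro sum.cong) auto
  have xV: "x \<in> V" and yV: "y \<in> V" using x y P_in_V by auto
  have card: "real (card (nbrs x)) = real t + 1" using card_nbrs_point[OF x] by simp
  have even: "even (dst x y)" using dst_parity[OF xV yV] x y by blast
  consider "x = y" | "dst x y = n" | "x \<noteq> y" "dst x y < n"
    using dst_le_n[OF xV yV] by linarith
  then show ?thesis
  proof cases
    case 1
    then show ?thesis
      unfolding * using sum_nbrs_same[OF xV, of h] card
      by (simp add: radial_collinearity_def dst_refl h_def numeral_2_eq_2)
  next
    case 2
    then show ?thesis
      unfolding * sum_nbrs_opposite[OF xV yV 2] card using n_ge_2
      by (simp add: radial_collinearity_def h_def numeral_2_eq_2)
  next
    case 3
    then have "dst x y \<noteq> 0" using dst_eq_0[OF xV yV] by simp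
    then obtain j where "dst x y = Suc (Suc j)" using even by (cases "dst x y"; cases "dst x y - 1") auto
    then show ?thesis
      unfolding * sum_nbrs_between[OF xV yV 3] card using 3(2)
      by (simp add: radial_collinearity_def h_def)
  qed
qed

lemma dst_points: "x \<in> P \<Longrightarrow> y \<in> P \<Longrightarrow> even (dst x y) \<and> dst x y \<le> n"
  using dst_parity[of x y] dst_le_n[of x y] P_in_V by simp

text \<open>Self-adjointness moves the operator from \<open>g\<close> to the radial kernel.\<close>

lemma radial_sum_eigenfunction:
  assumes g: "\<And>x. x \<in> P \<Longrightarrow> collinearity g x = \<kappa> * g x" and x: "x \<in> P"
  shows "\<kappa> * (\<Sum>w\<in>P. F (dst w x) * g w) = (\<Sum>w\<in>P. radial_collinearity F (dst w x) * g w)"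
proof -
  have "\<kappa> * (\<Sum>w\<in>P. F (dst w x) * g w) = (\<Sum>w\<in>P. F (dst w x) * collinearity g w)"
    using g by (simp add: sum_distrib_left mult.left_commute)
  also have "\<dots> = (\<Sum>w\<in>P. collinearity (\<lambda>z. F (dst z x)) w * g w)"
    by (rule collinearity_self_adjoint)
  also have "\<dots> = (\<Sum>w\<in>P. radial_collinearity F (dst w x) * g w)"
    using x by (intro sum.cong) (simp_all add: collinearity_radial)
  finally show ?thesis .
qed

lemma collinearity_const: "x \<in> P \<Longrightarrow> collinearity (\<lambda>_. 1) x = (real s + 1) * (real t + 1)"
proof -
  assume x: "x \<in> P"
  have "collinearity (\<lambda>_. 1) x = (\<Sum>l\<in>nbrs x. real s + 1)"
    unfolding collinearity_def using card_nbrs_line[OF nbrs_point[OF x]] by (intro sum.cong) simp_all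
  then show ?thesis using card_nbrs_point[OF x] by simp
qed

section \<open>Eigenfunctions and their sums over spheres\<close>

definition eigenfunction :: "real \<Rightarrow> ('a \<Rightarrow> real) \<Rightarrow> bool" where
  "eigenfunction \<kappa> g \<longleftrightarrow> (\<forall>x\<in>P. collinearity g x = \<kappa> * g x)"

definition sphere_sum :: "('a \<Rightarrow> real) \<Rightarrow> 'a \<Rightarrow> nat \<Rightarrow> real" where
  "sphere_sum g x j = (\<Sum>w\<in>P. of_bool (dst w x = j) * g w)"

lemma radial_sum_by_spheres:
  assumes x: "x \<in> P"
  shows "(\<Sum>w\<in>P. F (dst w x) * g w) = (\<Sum>i\<le>n div 2. F (2 * i) * sphere_sum g x (2 * i))"
proof -
  have "F (dst w x) = (\<Sum>i\<le>n div 2. F (2 * i) * of_bool (dst w x = 2 * i))" if w: "w \<in> P" for w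
  proof -
    obtain k where k: "dst w x = 2 * k" "k \<le> n div 2"
      using dst_points[OF w x] by (auto elim!: evenE)
    have "(\<Sum>i\<le>n div 2. F (2 * i) * of_bool (dst w x = 2 * i)) = (\<Sum>i\<le>n div 2. if k = i then F (2 * i) else 0)"
      unfolding k by (intro sum.cong) auto
    then show ?thesis using k by simp
  qed
  then have "(\<Sum>w\<in>P. F (dst w x) * g w) =
      (\<Sum>w\<in>P. \<Sum>i\<le>n div 2. F (2 * i) * (of_bool (dst w x = 2 * i) * g w))"
    by (intro sum.cong refl) (simp only: sum_distrib_right mult.assoc)
  also have "\<dots> = (\<Sum>i\<le>n div 2. F (2 * i) * sphere_sum g x (2 * i))"
    unfolding sphere_sum_def by (subst sum.swap) (simp add: sum_distrib_left)
  finally show ?thesis .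
qed

lemma sphere_sum_0:
  assumes x: "x \<in> P"
  shows "sphere_sum g x 0 = g x"
proof -
  have "sphere_sum g x 0 = (\<Sum>w\<in>P. if w = x then g w else 0)"
    unfolding sphere_sum_def using x P_in_V dst_eq_0 by (intro sum.cong) auto
  then show ?thesis using x finite_P by simp
qed

text \<open>With the indicator of distance \<open>j\<close> as kernel, this becomes a recurrence
  that determines all sphere sums from the value of \<open>g\<close> at \<open>x\<close>.\<close>

lemma sphere_sum_recurrence:
  assumes "eigenfunction \<kappa> g" "x \<in> P"
  shows "\<kappa> * sphere_sum g x j = (\<Sum>i\<le>n div 2.
    radial_collinearity (\<lambda>i. of_bool (i = j)) (2 * i) * sphere_sum g x (2 * i))"
  unfolding radial_sum_by_spheres[OF assms(2), symmetric]
  using radial_sum_eigenfunction[of g \<kappa> x "\<lambda>i. of_bool (i = j)"] assms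
  by (simp add: eigenfunction_def sphere_sum_def)

lemma eigenfunction_const: "eigenfunction ((real s + 1) * (real t + 1)) (\<lambda>_. 1)"
  unfolding eigenfunction_def by (simp add: collinearity_const)

lemma eigenfunction_radial:
  assumes "y \<in> P" "\<And>i. i \<le> n div 2 \<Longrightarrow> radial_collinearity F (2 * i) = \<kappa> * F (2 * i)"
  shows "eigenfunction \<kappa> (\<lambda>z. F (dst z y))"
  unfolding eigenfunction_def
proof
  fix x assume x: "x \<in> P"
  obtain k where k: "dst x y = 2 * k" "k \<le> n div 2"
    using dst_points[OF x assms(1)] by (auto elim!: evenE)
  then show "collinearity (\<lambda>z. F (dst z y)) x = \<kappa> * F (dst x y)"
    using collinearity_radial[OF x assms(1), of F] assms(2)[of k] by simp
qed

text \<open>\<open>w1\<close>, \<open>w2\<close>, \<open>w3\<close> are the eigenvalues on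
  \<open>g\<close> of the relations of being at distance 2, 4, 6. The factor \<open>t + 1\<close> of
  \<open>w3\<close> appears because all \<open>t + 1\<close> lines on a point opposite
  \<open>x\<close> lead back towards \<open>x\<close>.\<close>

lemma hexagon_radial_sum:
  fixes F :: "nat \<Rightarrow> real" and \<kappa> w1 w2 w3 :: real
  assumes n: "n = 6" and g: "eigenfunction \<kappa> g" and x: "x \<in> P"
    and w1: "w1 = \<kappa> - t - 1" and w2: "w2 = (\<kappa> - s - t) * w1 - (t + 1) * s"
    and w3: "(t + 1) * w3 = (\<kappa> - s - t) * w2 - s * t * w1"
  shows "(\<Sum>w\<in>P. F (dst w x) * g w) = (F 0 + F 2 * w1 + F 4 * w2 + F 6 * w3) * g x"
proof -
  let ?S = "sphere_sum g x"
  have S0: "?S 0 = g x" by (rule sphere_sum_0[OF x])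
  have e: "{..3} = {0, 1, 2, 3 :: nat}" by auto
  note rec = sphere_sum_recurrence[OF g x, unfolded radial_collinearity_def, unfolded n, simplified]
  have "\<kappa> * ?S 0 = (t + 1) * ?S 0 + ?S 2" using rec[of 0] by (simp add: e algebra_simps flip: numeral_2_eq_2)
  then have S2: "?S 2 = w1 * g x" unfolding S0 w1 by (simp add: algebra_simps)
  have "\<kappa> * ?S 2 = (t + 1) * s * ?S 0 + (s + t) * ?S 2 + ?S 4" using rec[of 2] by (simp add: e algebra_simps flip: numeral_2_eq_2)
  then have S4: "?S 4 = w2 * g x" unfolding S0 S2 w2 by (simp add: algebra_simps)
  have "\<kappa> * ?S 4 = s * t * ?S 2 + (s + t) * ?S 4 + (t + 1) * ?S 6" using rec[of 4] by (simp add: e algebra_simps flip: numeral_2_eq_2)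
  then have "(t + 1) * ?S 6 = (t + 1) * w3 * g x" unfolding S2 S4 w3 by (simp add: algebra_simps)
  then have S6: "?S 6 = w3 * g x" by simp
  show ?thesis unfolding radial_sum_by_spheres[OF x] n using S0 S2 S4 S6 
    by (simp add: e algebra_simps flip: numeral_2_eq_2)
qed

lemma octagon_radial_sum:
  fixes F :: "nat \<Rightarrow> real" and \<kappa> w1 w2 w3 w4 :: real
  assumes n: "n = 8" and g: "eigenfunction \<kappa> g" and x: "x \<in> P"
    and w1: "w1 = \<kappa> - t - 1" and w2: "w2 = (\<kappa> - s - t) * w1 - (t + 1) * s"
    and w3: "w3 = (\<kappa> - s - t) * w2 - s * t * w1"
    and w4: "(t + 1) * w4 = (\<kappa> - s - t) * w3 - s * t * w2"
  shows "(\<Sum>w\<in>P. F (dst w x) * g w) = (F 0 + F 2 * w1 + F 4 * w2 + F 6 * w3 + F 8 * w4) * g x"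
proof -
  let ?S = "sphere_sum g x"
  have S0: "?S 0 = g x" by (rule sphere_sum_0[OF x])
  have e: "{..4} = {0, 1, 2, 3, 4 :: nat}" by auto
  note rec = sphere_sum_recurrence[OF g x, unfolded radial_collinearity_def, unfolded n, simplified]
  have "\<kappa> * ?S 0 = (t + 1) * ?S 0 + ?S 2" using rec[of 0] by (simp add: e algebra_simps flip: numeral_2_eq_2)
  then have S2: "?S 2 = w1 * g x" unfolding S0 w1 by (simp add: algebra_simps)
  have "\<kappa> * ?S 2 = (t + 1) * s * ?S 0 + (s + t) * ?S 2 + ?S 4" using rec[of 2] by (simp add: e algebra_simps flip: numeral_2_eq_2)
  then have S4: "?S 4 = w2 * g x" unfolding S0 S2 w2 by (simp add: algebra_simps)
  have "\<kappa> * ?S 4 = s * t * ?S 2 + (s + t) * ?S 4 + ?S 6" using rec[of 4] by (simp add: e algebra_simps flip: numeral_2_eq_2)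
  then have S6: "?S 6 = w3 * g x" unfolding S2 S4 w3 by (simp add: algebra_simps)
  have "\<kappa> * ?S 6 = s * t * ?S 4 + (s + t) * ?S 6 + (t + 1) * ?S 8" using rec[of 6] by (simp add: e algebra_simps flip: numeral_2_eq_2)
  then have "(t + 1) * ?S 8 = (t + 1) * w4 * g x" unfolding S4 S6 w4 by (simp add: algebra_simps)
  then have S8: "?S 8 = w4 * g x" by simp
  show ?thesis unfolding radial_sum_by_spheres[OF x] n using S0 S2 S4 S6 S8
    by (simp add: e algebra_simps flip: numeral_2_eq_2)
qed

text \<open>For the constant eigenfunction the weights are the sizes of the spheres around a
  point.\<close>

lemma hexagon_card_points:
  assumes n: "n = 6"
  shows "real (card P) = (1 + real s) * (1 + real s * real t + (real s * real t)\<^sup>2)"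
proof -
  obtain x where x: "x \<in> P" using exists_point by blast
  have "(\<Sum>w\<in>P. (\<lambda>_. 1) (dst w x) * (\<lambda>_. 1) w) =
      (1 + 1 * (real s * (t + 1)) + 1 * (real s ^ 2 * t * (t + 1)) + 1 * (real s ^ 3 * t\<^sup>2)) * 1"
    by (rule hexagon_radial_sum[OF n eigenfunction_const x])
      (simp_all add: algebra_simps power2_eq_square power3_eq_cube)
  then show ?thesis by (simp add: algebra_simps power2_eq_square power3_eq_cube)
qed

lemma octagon_card_points:
  assumes n: "n = 8"
  shows "real (card P) = (1 + real s) * (1 + real s * real t) * (1 + (real s * real t)\<^sup>2)"
proof -
  obtain x where x: "x \<in> P" using exists_point by blast
  have "(\<Sum>w\<in>P. (\<lambda>_. 1) (dst w x) * (\<lambda>_. 1) w) =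
      (1 + 1 * (real s * (t + 1)) + 1 * (real s ^ 2 * t * (t + 1)) + 1 * (real s ^ 3 * t\<^sup>2 * (t + 1))
       + 1 * (real s ^ 4 * real t ^ 3)) * 1"
    by (rule octagon_radial_sum[OF n eigenfunction_const x])
      (simp_all add: algebra_simps power2_eq_square power3_eq_cube power4_eq_xxxx)
  then show ?thesis by (simp add: algebra_simps power2_eq_square power3_eq_cube power4_eq_xxxx)
qed

section \<open>The trace of a collineation\<close>

lemma collineation_dst:
  assumes \<theta>: "collineation \<Gamma> \<theta>" and "x \<in> V" "y \<in> V"
  shows "dst (\<theta> x) (\<theta> y) = dst x y"
proof -
  have bij: "\<theta> ` V = V" "inj_on \<theta> V" using \<theta> unfolding collineation_def bij_betw_def by auto
  have adj: "(\<theta> u, \<theta> v) \<in> G \<longleftrightarrow> (u, v) \<in> G" if "u \<in> V" "v \<in> V" for u v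
    using \<theta> that unfolding collineation_def by simp
  have "(\<theta> x, w) \<in> G ^^ k \<longleftrightarrow> (\<exists>u\<in>V. w = \<theta> u \<and> (x, u) \<in> G ^^ k)" for k w
  proof (induction k arbitrary: w)
    case 0
    then show ?case using assms(2) by auto
  next
    case (Suc k)
    show ?case
    proof
      assume "(\<theta> x, w) \<in> G ^^ Suc k"
      then obtain v where v: "(\<theta> x, v) \<in> G ^^ k" "(v, w) \<in> G" by (meson relpow_Suc_E)
      then obtain u where u: "u \<in> V" "v = \<theta> u" "(x, u) \<in> G ^^ k" using Suc.IH by blast
      have "w \<in> \<theta> ` V" using adj_types(2)[OF v(2)] bij(1) by simp
      then obtain u' where u': "u' \<in> V" "w = \<theta> u'" by blast
      then have "(u, u') \<in> G" using adj[OF u(1) u'(1)] v(2) u(2) by simp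
      then show "\<exists>u\<in>V. w = \<theta> u \<and> (x, u) \<in> G ^^ Suc k" using u u' by auto
    next
      assume "\<exists>u\<in>V. w = \<theta> u \<and> (x, u) \<in> G ^^ Suc k"
      then obtain u where u: "u \<in> V" "w = \<theta> u" "(x, u) \<in> G ^^ Suc k" by blast
      then obtain v where v: "(x, v) \<in> G ^^ k" "(v, u) \<in> G" by (meson relpow_Suc_E)
      then have "(\<theta> x, \<theta> v) \<in> G ^^ k" using Suc.IH adj_types(1) by blast
      then show "(\<theta> x, w) \<in> G ^^ Suc k" using adj adj_types[OF v(2)] v(2) u(2) by auto
    qed
  qed
  then have "(\<theta> x, \<theta> y) \<in> G ^^ k \<longleftrightarrow> (x, y) \<in> G ^^ k" for k
    using assms(3) inj_onD[OF bij(2)] by metis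
  then show ?thesis unfolding dst_def by simp
qed

text \<open>Every entry that contributes to the trace is \<open>F n\<close>. The exponent
  \<open>N\<close> depends on \<theta> alone and precedes \<open>F\<close> and \<open>c\<close>, so
  that traces from different eigenspaces lie in the same ring.\<close>

lemma radial_idempotent_trace:
  assumes \<theta>: "collineation \<Gamma> \<theta>" and opp: "\<And>p. p \<in> P \<Longrightarrow> dst p (\<theta> p) = n"
  shows "\<exists>N>0. \<forall>(F :: nat \<Rightarrow> real) c. c \<noteq> 0 \<longrightarrow>
    (\<forall>x\<in>P. \<forall>y\<in>P. (\<Sum>w\<in>P. F (dst w x) * F (dst w y)) = c * F (dst x y)) \<longrightarrow>
    complex_of_real (card P * F n / c) \<in> multiplier_ring N (cis (2 * pi / N))"
proof -
  have bij: "bij_betw \<theta> P P"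
    using \<theta> P_subset_V unfolding collineation_def bij_betw_def by (auto intro: inj_on_subset)
  obtain N where N: "N > 0" "\<And>x. x \<in> P \<Longrightarrow> (\<theta> ^^ N) x = x"
    using bij_betw_funpow_identity[OF finite_P bij] by blast
  have "complex_of_real (card P * F n / c) \<in> multiplier_ring N (cis (2 * pi / N))"
    if c: "c \<noteq> 0" and F: "\<forall>x\<in>P. \<forall>y\<in>P. (\<Sum>w\<in>P. F (dst w x) * F (dst w y)) = c * F (dst x y)" for F :: "nat \<Rightarrow> real" and c
  proof -
    have "complex_of_real ((\<Sum>x\<in>P. F (dst x (\<theta> x))) / c) \<in> multiplier_ring N (cis (2 * pi / N))"
    proof (rule trace_idempotent_permutation[OF finite_P bij N])
      fix x y assume xy: "x \<in> P" "y \<in> P"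
      then show "F (dst (\<theta> x) (\<theta> y)) = F (dst x y)"
        using collineation_dst[OF \<theta>] P_in_V by simp
      have "(\<Sum>z\<in>P. F (dst x z) * F (dst z y)) = (\<Sum>w\<in>P. F (dst w x) * F (dst w y))"
        by (simp only: dst_sym[of x])
      then show "(\<Sum>z\<in>P. F (dst x z) * F (dst z y)) = c * F (dst x y)" using F xy by simp
    qed (use c in auto)
    also have "(\<Sum>x\<in>P. F (dst x (\<theta> x))) = card P * F n" using opp by simp
    finally show ?thesis .
  qed
  then show ?thesis using N(1) by blast
qed

text \<open>\<open>F\<close> is the radial eigenfunction with \<open>F 0 = 1\<close> for the eigenvalue \<open>s - 1 + x\<close> of the
  collinearity graph; \<open>octagon_idempotent\<close> is the case \<open>x = 0\<close>.\<close>
lemma hexagon_idempotent: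
  fixes x :: real
  assumes n: "n = 6" and x: "x\<^sup>2 = real s * real t"
  shows "\<exists>F c. c = 2 * (1 - x + real s * real t) * (real s + real t + x) / (real s * real t * (real t + 1)) \<and>
    F n = - x / (real s * real t)\<^sup>2 \<and>
    (\<forall>u\<in>P. \<forall>v\<in>P. (\<Sum>w\<in>P. F (dst w u) * F (dst w v)) = c * F (dst u v))"
proof -
  define S where "S = real s"
  define T where "T = real t"
  have pos: "S > 0" "T > 0" using order_ge_2 by (auto simp: S_def T_def)
  then have nz: "S \<noteq> 0" "T \<noteq> 0" "T + 1 \<noteq> 0" by auto
  have xx: "x * x = S * T" using x by (simp add: power2_eq_square S_def T_def)
  define w1 where "w1 = S - 1 + x"
  define w2 where "w2 = x * (S - 1) - S"
  \<comment> \<open>The values at 2, 4, 6 are \<open>w1\<close>, \<open>w2\<close>,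
    \<open>- x * S\<close> divided by the sphere sizes \<open>S (T + 1)\<close>,
    \<open>S^2 T (T + 1)\<close>, \<open>S^3 T^2\<close>; the last branch serves
    \<open>j = 6\<close>.\<close>
  define F :: "nat \<Rightarrow> real" where "F j = (if j = 0 then 1 else if j = 2 then w1 / (S * (T + 1))
    else if j = 4 then w2 / (S\<^sup>2 * T * (T + 1)) else - x / (S * T)\<^sup>2)" for j
  have F: "F 0 = 1" "F 2 = w1 / (S * (T + 1))" "F 4 = w2 / (S\<^sup>2 * T * (T + 1))" "F 6 = - x / (S * T)\<^sup>2"
    by (simp_all add: F_def)
  \<comment> \<open>\<open>rel2\<close> and \<open>rel3\<close> are the recurrences of
    \<open>hexagon_radial_sum\<close> for the eigenvalue \<open>S + T + x\<close>.\<close>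
  have rel2: "w2 = x * w1 - (T + 1) * S" unfolding w1_def w2_def using xx by (simp add: algebra_simps)
  have rel3: "(T + 1) * (- (x * S)) = x * w2 - S * T * w1" 
  proof -
    have "x * w2 = S * T * (S - 1) - x * S" unfolding w2_def xx[symmetric] by (simp add: algebra_simps)
    then show ?thesis unfolding w1_def by (simp add: algebra_simps)
  qed
  have rad: "radial_collinearity F (2 * i) = (S + T + x) * F (2 * i)" if "i \<le> n div 2" for i
  proof -
    have "i = 0 \<or> i = 1 \<or> i = 2 \<or> i = 3" using that n by auto
    moreover have "radial_collinearity F 0 = (S + T + x) * F 0"
      unfolding radial_collinearity_def unfolding n S_def[symmetric] T_def[symmetric]
      using nz by (simp add: F w1_def divide_simps)
    moreover have "radial_collinearity F 2 = (S + T + x) * F 2"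
    proof -
      have "S * (T + 1) + (S + T) * w1 + w2 = (S + T + x) * w1" unfolding rel2 by (simp add: algebra_simps)
      moreover have "1 + (S + T) * F 2 + S * T * F 4 = (S * (T + 1) + (S + T) * w1 + w2) / (S * (T + 1))"
        unfolding F using nz by (simp add: divide_simps power2_eq_square, (simp add: algebra_simps)?)
      ultimately have "1 + (S + T) * F 2 + S * T * F 4 = (S + T + x) * F 2" by (simp add: F)
      then show ?thesis
        unfolding radial_collinearity_def unfolding n S_def[symmetric] T_def[symmetric]
        by (simp add: F(1) algebra_simps)
    qed
    moreover have "radial_collinearity F 4 = (S + T + x) * F 4"
    proof -
      have "S * T * w1 + (S + T) * w2 - x * S * (T + 1) = (S + T + x) * w2" using rel3 by (simp add: algebra_simps)
      moreover have "F 2 + (S + T) * F 4 + S * T * F 6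
          = (S * T * w1 + (S + T) * w2 - x * S * (T + 1)) / (S\<^sup>2 * T * (T + 1))"
        unfolding F using nz by (simp add: divide_simps power2_eq_square, (simp add: algebra_simps)?)
      ultimately have "F 2 + (S + T) * F 4 + S * T * F 6 = (S + T + x) * F 4" by (simp add: F)
      then show ?thesis
        unfolding radial_collinearity_def unfolding n S_def[symmetric] T_def[symmetric]
        by (simp add: algebra_simps)
    qed
    moreover have "radial_collinearity F 6 = (S + T + x) * F 6"
    proof -
      have "T * w2 - x * S * (T + 1) = - x * (S + T + x)" unfolding w2_def by (simp add: algebra_simps xx)
      moreover have "(T + 1) * (F 4 + S * F 6) = (T * w2 - x * S * (T + 1)) / (S * T)\<^sup>2"
        unfolding F using nz by (simp add: divide_simps power2_eq_square, (simp add: algebra_simps)?)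
      ultimately have "(T + 1) * (F 4 + S * F 6) = (S + T + x) * F 6" by (simp add: F)
      then show ?thesis
        unfolding radial_collinearity_def unfolding n S_def[symmetric] T_def[symmetric] by simp
    qed
    ultimately show ?thesis by auto
  qed
  define c where "c = 2 * (1 - x + S * T) * (S + T + x) / (S * T * (T + 1))"
  have "(\<Sum>w\<in>P. F (dst w u) * F (dst w v)) = c * F (dst u v)" if uv: "u \<in> P" "v \<in> P" for u v
  proof -
    have eig: "eigenfunction (S + T + x) (\<lambda>w. F (dst w v))"
      using eigenfunction_radial[OF uv(2)] rad by simp
    \<comment> \<open>The radial sum around \<open>u\<close> of the eigenfunction centred at
      \<open>v\<close> is a multiple of its value at \<open>u\<close>, so the kernel is idempotent
      up to the factor \<open>c\<close>.\<close>
    have "(\<Sum>w\<in>P. F (dst w u) * F (dst w v))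
        = (F 0 + F 2 * w1 + F 4 * w2 + F 6 * (- (x * S))) * F (dst u v)"
      using rel2 rel3 by (intro hexagon_radial_sum[OF n eig uv(1)]) (simp_all add: S_def T_def w1_def algebra_simps)
    also have "F 0 + F 2 * w1 + F 4 * w2 + F 6 * (- (x * S)) = c"
      using hexagon_norm[of S T x w1 w2] pos x unfolding F c_def
      by (simp add: w1_def w2_def S_def T_def)
    finally show ?thesis .
  qed
  then show ?thesis using F(4) unfolding n c_def S_def T_def by (intro exI[of _ F] exI conjI) auto
qed

lemma octagon_idempotent:
  assumes n: "n = 8"
  shows "\<exists>F c. c = 2 * (real s + real t) * (real s * real t + 1) / (real s * real t * (real t + 1)) \<and>
    F n = 1 / (real s * real t)\<^sup>2 \<and>
    (\<forall>u\<in>P. \<forall>v\<in>P. (\<Sum>w\<in>P. F (dst w u) * F (dst w v)) = c * F (dst u v))"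
proof -
  define S where "S = real s"
  define T where "T = real t"
  have pos: "S > 0" "T > 0" using order_ge_2 by (auto simp: S_def T_def)
  then have nz: "S \<noteq> 0" "T \<noteq> 0" "T + 1 \<noteq> 0" by auto
  \<comment> \<open>Again sphere sums divided by sphere sizes, here for the eigenvalue
    \<open>S + T\<close>.\<close>
  define F :: "nat \<Rightarrow> real" where "F j = (if j = 0 then 1 else if j = 2 then (S - 1) / (S * (T + 1))
    else if j = 4 then - 1 / (S * T) else if j = 6 then - (S - 1) / (S * (T + 1)) / (S * T)
    else 1 / (S * T)\<^sup>2)" for j
  have F: "F 0 = 1" "F 2 = (S - 1) / (S * (T + 1))" "F 4 = - 1 / (S * T)"
    "F 6 = - (S - 1) / (S * (T + 1)) / (S * T)" "F 8 = 1 / (S * T)\<^sup>2"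
    by (simp_all add: F_def)
  have rad: "radial_collinearity F (2 * i) = (S + T) * F (2 * i)" if "i \<le> n div 2" for i
  proof -
    have "i = 0 \<or> i = 1 \<or> i = 2 \<or> i = 3 \<or> i = 4" using that n by auto
    moreover have "radial_collinearity F 0 = (S + T) * F 0"
      "radial_collinearity F 2 = (S + T) * F 2" "radial_collinearity F 4 = (S + T) * F 4"
      "radial_collinearity F 6 = (S + T) * F 6" "radial_collinearity F 8 = (S + T) * F 8"
      unfolding radial_collinearity_def unfolding n S_def[symmetric] T_def[symmetric]
      using nz by (simp_all add: F divide_simps power2_eq_square) (simp_all add: algebra_simps)
    ultimately show ?thesis by auto
  qed
  define c where "c = 2 * (S + T) * (S * T + 1) / (S * T * (T + 1))"
  have "(\<Sum>w\<in>P. F (dst w u) * F (dst w v)) = c * F (dst u v)" if uv: "u \<in> P" "v \<in> P" for u v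
  proof -
    have eig: "eigenfunction (S + T) (\<lambda>w. F (dst w v))"
      using eigenfunction_radial[OF uv(2)] rad by simp
    have "(\<Sum>w\<in>P. F (dst w u) * F (dst w v))
        = (F 0 + F 2 * (S - 1) + F 4 * (- S * (T + 1)) + F 6 * (- S * T * (S - 1)) + F 8 * (S\<^sup>2 * T)) * F (dst u v)"
      by (intro octagon_radial_sum[OF n eig uv(1)])
        (simp_all add: S_def T_def power2_eq_square algebra_simps)
    also have "F 0 + F 2 * (S - 1) + F 4 * (- S * (T + 1)) + F 6 * (- S * T * (S - 1)) + F 8 * (S\<^sup>2 * T) = c"
      unfolding F c_def by (rule octagon_norm[OF pos])
    finally show ?thesis .
  qed
  then show ?thesis using F(5) unfolding n c_def S_def T_def by (intro exI[of _ F] exI conjI) auto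
qed

text \<open>For octagons a single trace is rational and thus an integer. For hexagons
  \<open>z1\<close> and \<open>z2\<close> may be irrational, but the ring contains
  \<open>z1 + z2\<close> and \<open>(z1 - z2)^2\<close>, which are rational.\<close>

lemma no_opposite_collineation:
  assumes n: "n = 6 \<or> n = 8" and \<theta>: "collineation \<Gamma> \<theta>"
  shows "\<exists>p\<in>P. dst p (\<theta> p) \<noteq> n"
proof (rule ccontr)
  assume "\<not> ?thesis"
  then have "\<And>p. p \<in> P \<Longrightarrow> dst p (\<theta> p) = n" by blast
  from radial_idempotent_trace[OF \<theta> this] obtain N where N: "N > 0"
    and tr: "\<And>(F :: nat \<Rightarrow> real) c. c \<noteq> 0 \<Longrightarrow>
      \<forall>x\<in>P. \<forall>y\<in>P. (\<Sum>w\<in>P. F (dst w x) * F (dst w y)) = c * F (dst x y) \<Longrightarrow>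
      complex_of_real (card P * F n / c) \<in> multiplier_ring N (cis (2 * pi / N))" by blast
  define R where "R = multiplier_ring N (cis (2 * pi / N))"
  have Ints: "a / b \<in> \<int>" if "complex_of_real (a / b) \<in> R" "a \<in> \<int>" "b \<in> \<int>" for a b :: real
  proof -
    have "complex_of_real (a / b) \<in> \<rat>" using that(2,3) by (auto elim!: Ints_cases)
    then have "complex_of_real (a / b) \<in> \<int>"
      using rational_multiplier_ring_Ints that(1) N unfolding R_def by blast
    then show ?thesis by (simp only: of_real_in_Ints_iff)
  qed
  have pos: "real s > 0" "real t > 0" using order_ge_2 by auto
  from n show False
  proof
    assume n: "n = 8"
    from octagon_idempotent[OF n] obtain F c
      where c: "c = 2 * (real s + real t) * (real s * real t + 1) / (real s * real t * (real t + 1))"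
        and Fn: "F n = 1 / (real s * real t)\<^sup>2"
        and F: "\<forall>u\<in>P. \<forall>v\<in>P. (\<Sum>w\<in>P. F (dst w u) * F (dst w v)) = c * F (dst u v)" by blast
    have "c > 0" unfolding c using pos by (intro divide_pos_pos mult_pos_pos add_pos_pos) auto
    then have "complex_of_real (card P * F n / c) \<in> R" using tr[OF _ F] unfolding R_def by simp
    also have "card P * F n / c = (1 + real s) * (1 + real t) * (1 + (real s)\<^sup>2 * (real t)\<^sup>2) /
        (2 * real s * real t * (real s + real t))"
      unfolding octagon_card_points[OF n] Fn c by (rule octagon_trace_value[OF pos])
    finally have "(1 + real s) * (1 + real t) * (1 + (real s)\<^sup>2 * (real t)\<^sup>2) /
        (2 * real s * real t * (real s + real t)) \<in> \<int>" by (rule Ints) auto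
    then have "real ((1 + s) * (1 + t) * (1 + s\<^sup>2 * t\<^sup>2)) / real (2 * s * t * (s + t)) \<in> \<int>"
      by (simp only: of_nat_add of_nat_mult of_nat_power of_nat_1 of_nat_numeral)
    then have "2 * s * t * (s + t) dvd (1 + s) * (1 + t) * (1 + s\<^sup>2 * t\<^sup>2)"
      using pos by (intro of_nat_divide_Ints_imp_dvd) auto
    then show False using octagon_parameters order_ge_2 by blast
  next
    assume n: "n = 6"
    define S where "S = real s"
    define T where "T = real t"
    define r where "r = sqrt (S * T)"
    have pST: "S > 0" "T > 0" using pos unfolding S_def T_def by auto
    then have rr: "r\<^sup>2 = S * T" unfolding r_def by simp
    have z: "complex_of_real (- x * (1 + S) * (1 + T) * (1 + x + S * T) / (2 * S * T * (S + T + x))) \<in> R"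
      if x: "x\<^sup>2 = S * T" for x
    proof -
      have "x\<^sup>2 = real s * real t" using x by (simp only: S_def T_def)
      from hexagon_idempotent[OF n this, folded S_def T_def] obtain F c
        where c: "c = 2 * (1 - x + S * T) * (S + T + x) / (S * T * (T + 1))"
          and Fn: "F n = - x / (S * T)\<^sup>2"
          and F: "\<forall>u\<in>P. \<forall>v\<in>P. (\<Sum>w\<in>P. F (dst w u) * F (dst w v)) = c * F (dst u v)"
        by (elim exE conjE) (rule that)
      have "complex_of_real (card P * F n / c) \<in> R"
        using tr[OF _ F] hexagon_trace_value(3)[OF pST x c] unfolding R_def by simp
      also have "card P * F n / c = - x * (1 + S) * (1 + T) * (1 + x + S * T) / (2 * S * T * (S + T + x))"
        unfolding hexagon_card_points[OF n] Fn
        using hexagon_trace_value(1)[OF pST x c] unfolding S_def T_def by simp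
      finally show ?thesis .
    qed
    define z1 where "z1 = - r * (1 + S) * (1 + T) * (1 + r + S * T) / (2 * S * T * (S + T + r))"
    define z2 where "z2 = r * (1 + S) * (1 + T) * (1 - r + S * T) / (2 * S * T * (S + T - r))"
    have z1: "complex_of_real z1 \<in> R" unfolding z1_def by (rule z[OF rr])
    have z2: "complex_of_real z2 \<in> R" using z[of "- r"] rr unfolding z2_def by simp
    have "S + T + r > 0" "S + T - r > 0"
      using hexagon_trace_value(2)[OF pST rr refl] hexagon_trace_value(2)[OF pST, of "- r", OF _ refl] rr by auto
    note vals = hexagon_trace_sum[OF pST rr this z1_def z2_def refl]
    define D where "D = (int s)\<^sup>2 + int s * int t + (int t)\<^sup>2"
    have D: "S\<^sup>2 + S * T + T\<^sup>2 = of_int D" unfolding D_def S_def T_def by simp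
    have "D > 0" using order_ge_2 unfolding D_def by (intro add_pos_pos) auto
    have "complex_of_real (z1 + z2) \<in> R"
      using multiplier_ring_add[OF z1[unfolded R_def] z2[unfolded R_def]] unfolding R_def by simp
    then have "(S\<^sup>2 - 1) * (T\<^sup>2 - 1) / of_int D \<in> \<int>"
      unfolding vals(1) D by (rule Ints) (auto simp: S_def T_def)
    then have "of_int (((int s)\<^sup>2 - 1) * ((int t)\<^sup>2 - 1)) / (of_int D :: real) \<in> \<int>"
      unfolding S_def T_def by simp
    then have 1: "D dvd ((int s)\<^sup>2 - 1) * ((int t)\<^sup>2 - 1)"
      using \<open>D > 0\<close> by (rule of_int_divide_Ints_imp_dvd)
    have "complex_of_real ((z1 - z2)\<^sup>2) \<in> R"
      using multiplier_ring_power[OF multiplier_ring_diff[OF z1[unfolded R_def] z2[unfolded R_def]], of 2]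
      unfolding R_def by simp
    then have "((1 + S) * (1 + T) * ((1 + S * T) * (S + T) - S * T))\<^sup>2 / (S * T * (of_int D)\<^sup>2) \<in> \<int>"
      unfolding vals(2) D by (rule Ints) (auto simp: S_def T_def)
    then have "of_int (((1 + int s) * (1 + int t) * ((1 + int s * int t) * (int s + int t) - int s * int t))\<^sup>2) /
        (of_int (int s * int t * D\<^sup>2) :: real) \<in> \<int>"
      unfolding S_def T_def by simp
    then have "int s * int t * D\<^sup>2 dvd
        ((1 + int s) * (1 + int t) * ((1 + int s * int t) * (int s + int t) - int s * int t))\<^sup>2"
      using \<open>D > 0\<close> order_ge_2 by (intro of_int_divide_Ints_imp_dvd) auto
    then show False using hexagon_parameters[OF order_ge_2] 1 unfolding D_def by blast
  qed
qed

section \<open>Anisotropic automorphisms\<close>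

lemma opposite_dst: "opposite n \<Gamma> x y \<Longrightarrow> x \<in> V \<and> y \<in> V \<and> dst x y = n"
proof -
  assume o: "opposite n \<Gamma> x y"
  then have v: "x \<in> V" "y \<in> V" unfolding opposite_def by auto
  have "incidence_dist \<Gamma> x y = enat (dst x y)" unfolding incidence_dist_def
  proof (rule antisym)
    show "(INF k\<in>{k. (x, y) \<in> G ^^ k}. enat k) \<le> enat (dst x y)"
      using dst_relpow[OF v] by (intro INF_lower) simp
    show "enat (dst x y) \<le> (INF k\<in>{k. (x, y) \<in> G ^^ k}. enat k)"
      using dst_le by (intro INF_greatest) simp
  qed
  then show ?thesis using o v unfolding opposite_def by simp
qed

lemma no_anisotropic_duality:
  assumes \<theta>: "duality \<Gamma> \<theta>" and an: "anisotropic n \<Gamma> \<theta>"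
  shows False
proof -
  obtain p where p: "p \<in> P" using exists_point by blast
  then have "nbrs p \<noteq> {}" using card_nbrs_ge_3[OF P_in_V] by force
  then obtain l where l: "l \<in> nbrs p" by blast
  then have lV: "l \<in> V - P" using nbrs_point[OF p] by blast
  have types: "\<And>u. u \<in> P \<Longrightarrow> \<theta> u \<in> lines \<Gamma>" "\<And>u. u \<in> lines \<Gamma> \<Longrightarrow> \<theta> u \<in> P"
    using \<theta> unfolding duality_def by auto
  have disj: "P \<inter> lines \<Gamma> = {}"
    using polygon unfolding generalised_polygon_def point_line_geometry_def by blast
  have lL: "l \<in> lines \<Gamma>" using lV unfolding elements_def by blast
  have q: "\<theta> l \<in> P" using types(2)[OF lL] .
  \<comment> \<open>A duality sends the chamber of \<open>u\<close> and \<open>l\<close> to one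
    whose point is \<open>\<theta> l\<close>, so every point of \<open>l\<close> has to be opposite
    \<open>\<theta> l\<close>.\<close>
  have opp: "dst u (\<theta> l) = n" if u: "u \<in> nbrs l" for u
  proof -
    have ul: "(u, l) \<in> G" using u adj_sym by (simp add: mem_nbrs)
    then have uP: "u \<in> P" using adj_types(3) lV by blast
    then have "(u, l) \<in> inc \<Gamma>" using inc_iff_adj ul by simp
    then have "chamber \<Gamma> {u, l}" unfolding chamber_def by blast
    then have "opposite_chambers n \<Gamma> {u, l} (\<theta> ` {u, l})" using an unfolding anisotropic_def by blast
    then obtain a b a' b' where ab: "(a, b) \<in> inc \<Gamma>" "(a', b') \<in> inc \<Gamma>" "{u, l} = {a, b}"
      "\<theta> ` {u, l} = {a', b'}" "opposite n \<Gamma> a a'"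
      unfolding opposite_chambers_def by blast
    have "a \<in> P" "a' \<in> P" using ab(1,2) polygon
      unfolding generalised_polygon_def point_line_geometry_def by auto
    then have "a = u" "a' = \<theta> l"
      using ab(3,4) lV types(1)[OF uP] disj by (auto simp: doubleton_eq_iff)
    then show ?thesis using ab(5) opposite_dst by blast
  qed
  have "l \<noteq> \<theta> l" using q lV by (metis DiffD2)
  then obtain z where z: "(l, z) \<in> G" "dst l (\<theta> l) = Suc (dst z (\<theta> l))"
    using closer_neighbour[of l "\<theta> l"] lV P_in_V[OF q] by blast
  \<comment> \<open>The point \<open>z\<close> of \<open>l\<close> is closer to
    \<open>\<theta> l\<close> than \<open>l\<close> is, so distance \<open>n\<close> from
    \<open>z\<close> would mean distance \<open>n + 1\<close> from \<open>l\<close>.\<close>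
  then show False using opp[of z] dst_le_n[of l "\<theta> l"] lV P_in_V[OF q] by (auto simp: mem_nbrs)
qed

lemma anisotropic_collineation_opposite:
  assumes \<theta>: "collineation \<Gamma> \<theta>" and an: "anisotropic n \<Gamma> \<theta>" and p: "p \<in> P"
  shows "dst p (\<theta> p) = n"
proof -
  have "nbrs p \<noteq> {}" using card_nbrs_ge_3[OF P_in_V[OF p]] by force
  then obtain l where l: "(p, l) \<in> G" by (auto simp: mem_nbrs)
  have disj: "P \<inter> lines \<Gamma> = {}"
    using polygon unfolding generalised_polygon_def point_line_geometry_def by blast
  have lL: "l \<in> lines \<Gamma>" using adj_types[OF l] p unfolding elements_def by blast
  have "(p, l) \<in> inc \<Gamma>" using inc_iff_adj p l by simp
  then have "chamber \<Gamma> {p, l}" unfolding chamber_def by blast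
  then have "opposite_chambers n \<Gamma> {p, l} (\<theta> ` {p, l})" using an unfolding anisotropic_def by blast
  then obtain a b a' b' where ab: "(a, b) \<in> inc \<Gamma>" "(a', b') \<in> inc \<Gamma>" "{p, l} = {a, b}"
    "\<theta> ` {p, l} = {a', b'}" "opposite n \<Gamma> a a'"
    unfolding opposite_chambers_def by blast
  have "a \<in> P" "a' \<in> P" using ab(1,2) polygon
    unfolding generalised_polygon_def point_line_geometry_def by auto
  moreover have "\<theta> l \<in> lines \<Gamma>" using \<theta> lL unfolding collineation_def by blast
  ultimately have "a = p" "a' = \<theta> p" using ab(3,4) lL disj by (auto simp: doubleton_eq_iff)
  then show ?thesis using ab(5) opposite_dst by blast
qed

end

theorem theorem2p15:
  fixes n :: nat and \<Gamma> :: "'a pl_geometry"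
  assumes "n = 6 \<or> n = 8"
    and "generalised_polygon n \<Gamma>"
    and "finite_geometry \<Gamma>"
    and "thick \<Gamma>"
  shows "\<not> (\<exists>\<theta>. automorphism \<Gamma> \<theta> \<and> anisotropic n \<Gamma> \<theta>)"
proof
  assume "\<exists>\<theta>. automorphism \<Gamma> \<theta> \<and> anisotropic n \<Gamma> \<theta>"
  then obtain \<theta> where \<theta>: "collineation \<Gamma> \<theta> \<or> duality \<Gamma> \<theta>" "anisotropic n \<Gamma> \<theta>"
    unfolding automorphism_def by blast
  interpret finite_thick_polygon n \<Gamma>
    using assms by unfold_locales auto
  show False
    using \<theta> no_anisotropic_duality no_opposite_collineation[OF assms(1)]
      anisotropic_collineation_opposite by blast
qed
end
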